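(* Let $V$ be a $\mathbb{Q}[\operatorname{SL}_2(\mathbb{Z})]$-module. Suppose that for every unipotent element $u \in \operatorname{SL}_2(\mathbb{Z})$ one has $(u-1)^5 = 0$ in $\operatorname{End} V$. Then $V$ has a finite series of $\mathbb{Q}[\operatorname{SL}_2(\mathbb{Z})]$-submodules $0 = V_0 \leq V_1 \leq \dots \leq V_m = V$ (a composition series in the paper's sense) each factor $V_j/V_{j-1}$ of which is a direct sum of copies of $\mathbb{Q}\otimes_\mathbb{Z} \operatorname{Sym}^k \operatorname{Nat} \operatorname{SL}_2(\mathbb{Z})$ for some $k \in \{0, \dots, 4\}$.
   Context: $\operatorname{SL}_2(\mathbb{Z})$ is regarded as an abstract group. $\operatorname{Nat}\operatorname{SL}_2(\mathbb{Z})$ is $\mathbb{Z}^2$ with the natural action, and $\operatorname{Sym}^k \operatorname{Nat} \operatorname{SL}_2(\mathbb{Z})$ its $k$-th symmetric power; thus $\mathbb{Q}\otimes_\mathbb{Z} \operatorname{Sym}^k \operatorname{Nat} \operatorname{SL}_2(\mathbb{Z})$ is the $(k+1)$-dimensional $\mathbb{Q}$-space of homogeneous polynomials of degree $k$ in $X,Y$, with the usual action of $\operatorname{SL}_2(\mathbb{Z})\leq \operatorname{SL}_2(\mathbb{Q})$ by linear substitution. *)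

theory Defs
  imports "HOL-Analysis.Analysis"
begin

definition SL2Z :: "(int^2^2) set" where
  "SL2Z = {g. det g = 1}"

definition unipotent :: "int^2^2 \<Rightarrow> bool" where
  "unipotent u \<longleftrightarrow> u \<in> SL2Z \<and> (\<exists>n. ((\<lambda>M. (u - mat 1) ** M) ^^ n) (mat 1) = 0)"

definition QSL2_module :: "(rat \<Rightarrow> 'v::ab_group_add \<Rightarrow> 'v) \<Rightarrow> (int^2^2 \<Rightarrow> 'v \<Rightarrow> 'v) \<Rightarrow> bool" where
  "QSL2_module smul act \<longleftrightarrow>
     vector_space smul \<and>
     (\<forall>g\<in>SL2Z. Vector_Spaces.linear smul smul (act g)) \<and>
     act (mat 1) = id \<and>
     (\<forall>g\<in>SL2Z. \<forall>h\<in>SL2Z. act (g ** h) = act g \<circ> act h)"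

definition submodule :: "(rat \<Rightarrow> 'v::ab_group_add \<Rightarrow> 'v) \<Rightarrow> (int^2^2 \<Rightarrow> 'v \<Rightarrow> 'v) \<Rightarrow> 'v set \<Rightarrow> bool" where
  "submodule smul act S \<longleftrightarrow>
     module.subspace smul S \<and> (\<forall>g\<in>SL2Z. \<forall>x\<in>S. act g x \<in> S)"

text \<open>Q \<otimes> Sym^k Nat: homogeneous polynomials of degree k in X, Y over Q,
  realised as the polynomial functions Q^2 \<rightarrow> Q (faithful since Q is infinite),
  with g = [[a,b],[c,d]] acting by linear substitution
  (g.P)(X,Y) = P(aX + cY, bX + dY), i.e. g.X = aX+cY, g.Y = bX+dY
  (the k-th symmetric power of the natural module Z^2 with basis X, Y).\<close>
definition Sym :: "nat \<Rightarrow> (rat \<times> rat \<Rightarrow> rat) set" where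
  "Sym k = {P. \<exists>c :: nat \<Rightarrow> rat. P = (\<lambda>(x, y). \<Sum>i\<le>k. c i * x ^ i * y ^ (k - i))}"

definition sym_act :: "int^2^2 \<Rightarrow> (rat \<times> rat \<Rightarrow> rat) \<Rightarrow> (rat \<times> rat \<Rightarrow> rat)" where
  "sym_act g P = (\<lambda>(x, y).
     P (of_int (g$1$1) * x + of_int (g$2$1) * y, of_int (g$1$2) * x + of_int (g$2$2) * y))"

definition dsum_Sym :: "nat \<Rightarrow> 'i set \<Rightarrow> ('i \<Rightarrow> rat \<times> rat \<Rightarrow> rat) set" where
  "dsum_Sym k I = {F. (\<forall>i\<in>I. F i \<in> Sym k) \<and> (\<forall>i. i \<notin> I \<longrightarrow> F i = (\<lambda>_. 0))
                      \<and> finite {i. F i \<noteq> (\<lambda>_. 0)}}"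

text \<open>The factor W/U (U \<subseteq> W submodules) is isomorphic, as a Q[SL_2(Z)]-module,
  to a direct sum of copies of Q \<otimes> Sym^k Nat: there is a Q-linear,
  SL_2(Z)-equivariant map from W onto the direct sum with kernel exactly U.
  (Index sets are taken inside the type 'v, which is large enough.)\<close>
definition factor_is_sum_Sym ::
  "(rat \<Rightarrow> 'v::ab_group_add \<Rightarrow> 'v) \<Rightarrow> (int^2^2 \<Rightarrow> 'v \<Rightarrow> 'v) \<Rightarrow> nat \<Rightarrow> 'v set \<Rightarrow> 'v set \<Rightarrow> bool" where
  "factor_is_sum_Sym smul act k U W \<longleftrightarrow>
     (\<exists>(I :: 'v set) (\<phi> :: 'v \<Rightarrow> 'v \<Rightarrow> rat \<times> rat \<Rightarrow> rat).
        (\<forall>x\<in>W. \<forall>y\<in>W. \<phi> (x + y) = (\<lambda>i p. \<phi> x i p + \<phi> y i p)) \<and>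
        (\<forall>r. \<forall>x\<in>W. \<phi> (smul r x) = (\<lambda>i. (\<lambda>p. r * \<phi> x i p))) \<and>
        (\<forall>g\<in>SL2Z. \<forall>x\<in>W. \<phi> (act g x) = (\<lambda>i. sym_act g (\<phi> x i))) \<and>
        \<phi> ` W = dsum_Sym k I \<and>
        (\<forall>x\<in>W. \<phi> x = (\<lambda>i p. 0) \<longleftrightarrow> x \<in> U))"

end

theory Submission
  imports Defs
begin

text \<open>Let \<open>u\<close> be the standard upper unipotent, \<open>w\<close> the Weyl element, and let \<open>v\<close> be fixed by \<open>u\<close> modulo
  a submodule \<open>U\<close>. Then \<open>g v\<close> modulo \<open>U\<close> depends only on the first column of \<open>g\<close>, so \<open>v\<close> is the same
  thing as a function \<open>F\<close> on primitive vectors of \<open>\<int>\<^sup>2\<close>, and \<open>(u - 1)\<^sup>5 = 0\<close> says that \<open>n \<mapsto> F (q + n det(p,q) p)\<close>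
  is a polynomial of degree at most 4. If the degree is at most \<open>k\<close> for unimodular \<open>(p, q)\<close>, taking the leading
  coefficient is the operator \<open>T = (u - 1)\<^sup>k w / k!\<close>. On functions with \<open>F (-p) = \<plusminus>F p\<close> finitely many of the
  polynomiality relations give \<open>T\<^sup>3 v = T\<^sup>2 v\<close>, and \<open>T\<^sup>2 v = 0\<close> if the sign is not \<open>(-1)\<^sup>k\<close>. A function with \<open>T F = F\<close>
  is a homogeneous polynomial of degree \<open>k\<close>, so \<open>T\<^sup>2 v\<close> generates copies of \<open>Sym\<^sup>k\<close> modulo \<open>U\<close>. Modulo these copies
  \<open>T v\<close>, and then \<open>v\<close>, has degree less than \<open>k\<close>; by descent on \<open>k\<close> a bounded number of extensions by sums of copies of
  \<open>Sym\<^sup>0, \<dots>, Sym\<^sup>4\<close> absorbs all vectors fixed modulo \<open>U\<close>. Applying this to \<open>(u - 1)\<^sup>4 x, \<dots>, (u - 1) x, x\<close> in turn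
  absorbs every \<open>x\<close>.\<close>


subsection \<open>Finite differences and two by two matrices\<close>

definition fdiff :: "(int \<Rightarrow> 'a::ab_group_add) \<Rightarrow> int \<Rightarrow> 'a" where
  "fdiff f n = f (n + 1) - f n"

lemma fdiff_pow_shift: "(fdiff ^^ k) (\<lambda>n. f (n + m)) n = (fdiff ^^ k) f (n + m)"
  by (induction k arbitrary: n) (simp_all add: fdiff_def algebra_simps)

lemma fdiff_pow_diff: "(fdiff ^^ k) (\<lambda>n. f n - g n) n = (fdiff ^^ k) f n - (fdiff ^^ k) g n"
  by (induction k arbitrary: n) (simp_all add: fdiff_def algebra_simps)

lemma fdiff_pow_mult:
  fixes f :: "int \<Rightarrow> 'a::comm_ring_1"
  shows "(fdiff ^^ k) (\<lambda>n. c * f n) n = c * (fdiff ^^ k) f n"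
  by (induction k arbitrary: n) (simp_all add: fdiff_def algebra_simps)

lemma fdiff_zero_const:
  fixes f :: "int \<Rightarrow> 'a::ab_group_add"
  assumes "\<And>n. fdiff f n = 0"
  shows "f n = f a"
proof -
  have s: "f (m + 1) = f m" for m using assms[of m] by (simp add: fdiff_def)
  show ?thesis
    by (induction n rule: int_induct[where k = a]) (use s in \<open>auto, metis diff_add_cancel\<close>)
qed

text \<open>A polynomial of degree below \<open>d\<close> is determined by \<open>d\<close>
  consecutive values. In the induction the first difference has one degree and one known zero less,
  so it vanishes and the function is constant.\<close>

lemma fdiff_pow_zero_unique:
  fixes f :: "int \<Rightarrow> 'a::ab_group_add"
  assumes "\<And>n. (fdiff ^^ d) f n = 0" and "\<And>j. j < d \<Longrightarrow> f (a + int j) = 0"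
  shows "f n = 0"
  using assms
proof (induction d arbitrary: f n)
  case 0
  then show ?case by simp
next
  case (Suc d)
  have "fdiff f m = 0" for m
  proof (rule Suc.IH)
    show "(fdiff ^^ d) (fdiff f) n = 0" for n
      using Suc.prems(1)[of n] by (simp only: funpow_Suc_right o_apply)
    show "fdiff f (a + int j) = 0" if "j < d" for j
      using Suc.prems(2)[of j] Suc.prems(2)[of "Suc j"] that by (simp add: fdiff_def ac_simps)
  qed
  then have "f n = f a" by (rule fdiff_zero_const)
  also have "f a = 0" using Suc.prems(2)[of 0] by simp
  finally show ?case .
qed

section \<open>Two by two integer matrices and completion of a primitive column\<close>

definition mat2 :: "int \<Rightarrow> int \<Rightarrow> int \<Rightarrow> int \<Rightarrow> int^2^2" where
  "mat2 a b c d = vector [vector [a, b], vector [c, d]]"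

lemma mat2_nth [simp]:
  "mat2 a b c d $ 1 $ 1 = a" "mat2 a b c d $ 1 $ 2 = b"
  "mat2 a b c d $ 2 $ 1 = c" "mat2 a b c d $ 2 $ 2 = d"
  by (simp_all add: mat2_def)

lemma mat2_eta: "mat2 (g$1$1) (g$1$2) (g$2$1) (g$2$2) = g"
  by (simp add: vec_eq_iff forall_2)

lemma mat2_mult [simp]:
  "mat2 a b c d ** mat2 a' b' c' d' = mat2 (a*a' + b*c') (a*b' + b*d') (c*a' + d*c') (c*b' + d*d')"
  by (simp add: vec_eq_iff forall_2 matrix_matrix_mult_def sum_2)

lemma mult_nth2:
  fixes g h :: "int^2^2"
  shows "(g ** h)$1$1 = g$1$1 * h$1$1 + g$1$2 * h$2$1" "(g ** h)$1$2 = g$1$1 * h$1$2 + g$1$2 * h$2$2"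
    "(g ** h)$2$1 = g$2$1 * h$1$1 + g$2$2 * h$2$1" "(g ** h)$2$2 = g$2$1 * h$1$2 + g$2$2 * h$2$2"
  by (simp_all add: matrix_matrix_mult_def sum_2)

lemma mat_1_mat2: "mat 1 = mat2 1 0 0 1"
  by (simp add: vec_eq_iff forall_2 mat_def)

lemma mat2_SL2Z [simp]: "mat2 a b c d \<in> SL2Z \<longleftrightarrow> a * d - b * c = 1"
  by (simp add: SL2Z_def det_2)

lemma SL2Z_cases:
  assumes "g \<in> SL2Z"
  obtains a b c d where "g = mat2 a b c d" "a * d - b * c = 1"
  using assms mat2_eta mat2_SL2Z by metis

lemma SL2Z_mult [simp]: "g \<in> SL2Z \<Longrightarrow> h \<in> SL2Z \<Longrightarrow> g ** h \<in> SL2Z"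
  by (simp add: SL2Z_def det_mul)

lemma ex_SL2Z_column:
  assumes "coprime (a::int) c"
  obtains b d where "a * d - b * c = 1"
proof -
  obtain x y where "x * a + y * c = 1" using bezout_int[of a c] assms by auto
  then show ?thesis using that[of x "- y"] by (simp add: algebra_simps)
qed

lemma SL2Z_column_coprime: "a * d - b * c = 1 \<Longrightarrow> coprime (a::int) c"
  by (rule coprimeI) (metis dvd_diff dvd_mult dvd_mult2)

subsection \<open>Functions on primitive vectors\<close>

lemma fdiff_pow_expand:
  fixes f :: "int \<Rightarrow> 'a::comm_ring_1"
  shows "(fdiff ^^ 1) f n = f (n + 1) - f n"
    "(fdiff ^^ 2) f n = f (n + 2) - 2 * f (n + 1) + f n"
    "(fdiff ^^ 3) f n = f (n + 3) - 3 * f (n + 2) + 3 * f (n + 1) - f n"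
    "(fdiff ^^ 4) f n = f (n + 4) - 4 * f (n + 3) + 6 * f (n + 2) - 4 * f (n + 1) + f n"
    "(fdiff ^^ 5) f n = f (n + 5) - 5 * f (n + 4) + 10 * f (n + 3) - 10 * f (n + 2) + 5 * f (n + 1) - f n"
  by (simp_all add: eval_nat_numeral fdiff_def algebra_simps)

text \<open>In the next definition \<open>F\<close> stands for a function on primitive vectors; its values at other vectors are
  irrelevant, and the sign rule is imposed on them only to keep it unconditional.\<close>

definition cusp_fun :: "rat \<Rightarrow> (int \<Rightarrow> int \<Rightarrow> rat) \<Rightarrow> bool" where
  "cusp_fun e F \<longleftrightarrow> (\<forall>x y. F (- x) (- y) = e * F x y) \<and>
     (\<forall>a b c d. coprime a c \<longrightarrow> coprime b d \<longrightarrow>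
        (fdiff ^^ 5) (\<lambda>n. F (b + n * (a * d - b * c) * a) (d + n * (a * d - b * c) * c)) 0 = 0)"

text \<open>The difference at 0 suffices: replacing \<open>(b, d)\<close> by
  \<open>(b + m a, d + m c)\<close> keeps the determinant, so all differences along the line are
  covered.\<close>

definition deg_less :: "nat \<Rightarrow> (int \<Rightarrow> int \<Rightarrow> rat) \<Rightarrow> bool" where
  "deg_less D F \<longleftrightarrow>
     (\<forall>a b c d. a * d - b * c = 1 \<longrightarrow> (fdiff ^^ D) (\<lambda>n. F (b + n * a) (d + n * c)) 0 = 0)"

text \<open>\<open>G a c\<close> is the coefficient of \<open>n^k\<close> on the line through
  \<open>(b, d)\<close> with direction \<open>(a, c)\<close>; part of the condition is that it
  depends on the direction alone.\<close>

definition lead :: "nat \<Rightarrow> (int \<Rightarrow> int \<Rightarrow> rat) \<Rightarrow> (int \<Rightarrow> int \<Rightarrow> rat) \<Rightarrow> bool" where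
  "lead k F G \<longleftrightarrow>
     (\<forall>a b c d. a * d - b * c = 1 \<longrightarrow>
        (fdiff ^^ k) (\<lambda>n. F (b + n * a) (d + n * c)) 0 = fact k * G a c)"

lemma cusp_fun_sign: "cusp_fun e F \<Longrightarrow> F (- x) (- y) = e * F x y"
  by (simp add: cusp_fun_def)

text \<open>Opposite vectors with numeral coordinates are brought to one representative, so that
  linear arithmetic sees a single unknown for the pair.\<close>

lemma cusp_fun_sign_simps:
  assumes "cusp_fun e F"
  shows "F (- numeral k) y = e * F (numeral k) (- y)" "F (- 1) y = e * F 1 (- y)"
    "F 0 (- numeral k) = e * F 0 (numeral k)" "F 0 (- 1) = e * F 0 1"
  using cusp_fun_sign[OF assms, of _ "- y"] cusp_fun_sign[OF assms, of 0] by simp_all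

text \<open>Coprimality is replaced by Bezout equations and the determinant is a parameter
  \<open>m\<close>, so that simplification discharges the premises of numerical instances. Lines
  with \<open>m = 2\<close> carry information that the unimodular ones alone do not state.\<close>

lemma cusp_line:
  assumes "cusp_fun e F" "x * a + y * c = 1" "z * b + w * d = 1" "m = a * d - b * c"
  shows "F (b + 5 * m * a) (d + 5 * m * c) - 5 * F (b + 4 * m * a) (d + 4 * m * c)
    + 10 * F (b + 3 * m * a) (d + 3 * m * c) - 10 * F (b + 2 * m * a) (d + 2 * m * c)
    + 5 * F (b + m * a) (d + m * c) - F b d = 0"
proof -
  have "coprime a c" "coprime b d"
    by (metis SL2Z_column_coprime assms(2) diff_minus_eq_add minus_mult_left mult.commute)
      (metis SL2Z_column_coprime assms(3) diff_minus_eq_add minus_mult_left mult.commute)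
  with assms(1) have "(fdiff ^^ 5) (\<lambda>n. F (b + n * (a * d - b * c) * a) (d + n * (a * d - b * c) * c)) 0 = 0"
    unfolding cusp_fun_def by blast
  then show ?thesis by (simp add: fdiff_pow_expand flip: assms(4))
qed

lemma line:
  assumes "deg_less D F" "a * d - b * c = 1"
  shows "(fdiff ^^ D) (\<lambda>n. F (b + n * a) (d + n * c)) 0 = 0"
  using assms by (simp add: deg_less_def)

lemma lead_eq:
  assumes "lead k F G" "a * d - b * c = 1"
  shows "(fdiff ^^ k) (\<lambda>n. F (b + n * a) (d + n * c)) 0 = fact k * G a c"
  using assms by (simp add: lead_def)

lemma fact_values: "fact 1 = (1::rat)" "fact 2 = (2::rat)" "fact 3 = (6::rat)" "fact 4 = (24::rat)"
  by (simp_all add: fact_numeral)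

text \<open>The lists of lines and linear combinations in the following lemmas were found by computer: sparse
  certificates for linear consequences of the line conditions at small primitive vectors.\<close>

lemma lead_sq_even_2:
  assumes F0: "cusp_fun 1 F0" and F1: "cusp_fun 1 F1" and D0: "deg_less 3 F0" and L0: "lead 2 F0 F1"
  shows "(fdiff ^^ 2) (\<lambda>n. F1 n 1) 0 = 2 * F1 1 0"
proof -
  note s = cusp_fun_sign_simps[OF F0] cusp_fun_sign_simps[OF F1] fdiff_pow_expand fact_values
  note r0 = lead_eq[OF L0, of 0 1 1 "-1", simplified s, simplified, simplified s, simplified]
  note r1 = lead_eq[OF L0, of 2 "-1" "-3" 1, simplified s, simplified, simplified s, simplified]
  note r2 = lead_eq[OF L0, of 1 1 "-1" 0, simplified s, simplified, simplified s, simplified]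
  note r3 = lead_eq[OF L0, of 1 1 1 0, simplified s, simplified, simplified s, simplified]
  note r4 = lead_eq[OF L0, of 1 "-1" "-2" 1, simplified s, simplified, simplified s, simplified]
  show ?thesis unfolding fdiff_pow_expand using r0 r1 r2 r3 r4 by (simp only: add_0_left)
qed

lemma lead_sq_odd_3:
  assumes F0: "cusp_fun (-1) F0" and F1: "cusp_fun (-1) F1" and D0: "deg_less 4 F0" and L0: "lead 3 F0 F1"
  shows "(fdiff ^^ 3) (\<lambda>n. F1 n 1) 0 = 6 * F1 1 0"
proof -
  note s = cusp_fun_sign_simps[OF F0] cusp_fun_sign_simps[OF F1] fdiff_pow_expand fact_values
  note r0 = lead_eq[OF L0, of 0 2 1 "-1", simplified s, simplified, simplified s, simplified]
  note r1 = lead_eq[OF L0, of 1 1 "-1" 0, simplified s, simplified, simplified s, simplified]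
  note r2 = lead_eq[OF L0, of "-1" 1 2 "-1", simplified s, simplified, simplified s, simplified]
  note r3 = lead_eq[OF L0, of 3 "-1" "-4" 1, simplified s, simplified, simplified s, simplified]
  note r4 = lead_eq[OF L0, of 2 "-2" "-5" 1, simplified s, simplified, simplified s, simplified]
  note r5 = line[OF D0, of 2 "-2" "-5" 1, simplified s, simplified, simplified s, simplified]
  note r6 = lead_eq[OF L0, of "-1" 2 3 "-1", simplified s, simplified, simplified s, simplified]
  note r7 = lead_eq[OF L0, of 1 1 1 0, simplified s, simplified, simplified s, simplified]
  note r8 = line[OF D0, of "-1" "-1" 0 0, simplified s, simplified, simplified s, simplified]
  show ?thesis unfolding fdiff_pow_expand using r0 r1 r2 r3 r4 r5 r6 r7 r8 by (simp only: add_0_left)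
qed

lemma lead_sq_odd_4:
  assumes F0: "cusp_fun (-1) F0"
    and F1: "cusp_fun (-1) F1"
    and F2: "cusp_fun (-1) F2"
    and L0: "lead 4 F0 F1"
    and L1: "lead 4 F1 F2"
  shows "F2 1 0 = 0"
proof -
  note s = cusp_fun_sign_simps[OF F0]
    cusp_fun_sign_simps[OF F1]
    cusp_fun_sign_simps[OF F2] fdiff_pow_expand fact_values
  note r0 = lead_eq[OF L0, of 2 2 "-3" "-1", simplified s, simplified, simplified s, simplified]
  note r1 = cusp_line[OF F0, of "-1" "-1" "-9" 0 "-3" 5 "-8" "-2" 2, simplified s, simplified, simplified s, simplified]
  note r2 = lead_eq[OF L0, of 2 "-2" "-5" 1, simplified s, simplified, simplified s, simplified]
  note r3 = lead_eq[OF L0, of 1 1 "-1" 0, simplified s, simplified, simplified s, simplified]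
  note r4 = lead_eq[OF L1, of 1 1 "-2" 0, simplified s, simplified, simplified s, simplified]
  note r5 = lead_eq[OF L0, of 0 "-2" "-1" 1, simplified s, simplified, simplified s, simplified]
  note r6 = lead_eq[OF L0, of 1 1 "-3" 0, simplified s, simplified, simplified s, simplified]
  note r7 = lead_eq[OF L0, of 1 "-2" "-3" 1, simplified s, simplified, simplified s, simplified]
  note r8 = lead_eq[OF L0, of 1 2 "-1" "-1", simplified s, simplified, simplified s, simplified]
  show ?thesis using r0 r1 r2 r3 r4 r5 r6 r7 r8 by linarith
qed

text \<open>Write \<open>T\<close> for the passage to the leading coefficient, evaluated at
  \<open>(1, 0)\<close>. With the right parity \<open>T F = F\<close> for \<open>k = 1\<close>, but
  only \<open>T (T F) = T F\<close> for \<open>k = 2, 3\<close>; with the wrong parity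
  \<open>T F = 0\<close> for \<open>k = 1, 2, 3\<close>, and \<open>T (T F) = 0\<close> for
  \<open>k = 4\<close>.\<close>

lemma lead_odd_1:
  assumes F0: "cusp_fun (-1) F0" and F1: "cusp_fun (-1) F1" and D0: "deg_less 2 F0" and L0: "lead 1 F0 F1"
  shows "F1 1 0 = F0 1 0"
proof -
  note s = cusp_fun_sign_simps[OF F0] cusp_fun_sign_simps[OF F1] fdiff_pow_expand fact_values
  note r0 = lead_eq[OF L0, of 1 1 "-1" 0, simplified s, simplified, simplified s, simplified]
  note r1 = line[OF D0, of "-1" "-1" 1 0, simplified s, simplified, simplified s, simplified]
  note r2 = line[OF D0, of 0 "-1" "-1" 1, simplified s, simplified, simplified s, simplified]
  show ?thesis using r0 r1 r2 by linarith
qed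

lemma lead_even_1:
  assumes F0: "cusp_fun 1 F0" and F1: "cusp_fun 1 F1" and D0: "deg_less 2 F0" and L0: "lead 1 F0 F1"
  shows "F1 1 0 = 0"
proof -
  note s = cusp_fun_sign_simps[OF F0] cusp_fun_sign_simps[OF F1] fdiff_pow_expand fact_values
  note r0 = lead_eq[OF L0, of 1 1 "-1" 0, simplified s, simplified, simplified s, simplified]
  note r1 = line[OF D0, of 0 0 "-1" 1, simplified s, simplified, simplified s, simplified]
  note r2 = line[OF D0, of "-1" "-2" 1 1, simplified s, simplified, simplified s, simplified]
  show ?thesis using r0 r1 r2 by linarith
qed

lemma lead_odd_2:
  assumes F0: "cusp_fun (-1) F0" and F1: "cusp_fun (-1) F1" and D0: "deg_less 3 F0" and L0: "lead 2 F0 F1"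
  shows "F1 1 0 = 0"
proof -
  note s = cusp_fun_sign_simps[OF F0] cusp_fun_sign_simps[OF F1] fdiff_pow_expand fact_values
  note r0 = lead_eq[OF L0, of 0 "-2" "-1" 1, simplified s, simplified, simplified s, simplified]
  note r1 = line[OF D0, of 1 1 "-2" 0, simplified s, simplified, simplified s, simplified]
  note r2 = line[OF D0, of "-1" "-2" 1 1, simplified s, simplified, simplified s, simplified]
  note r3 = lead_eq[OF L0, of 1 1 "-1" 0, simplified s, simplified, simplified s, simplified]
  note r4 = lead_eq[OF L0, of 1 1 0 0, simplified s, simplified, simplified s, simplified]
  note r5 = lead_eq[OF L0, of 0 0 "-1" 1, simplified s, simplified, simplified s, simplified]
  note r6 = line[OF D0, of 1 "-1" "-2" 1, simplified s, simplified, simplified s, simplified]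
  show ?thesis using r0 r1 r2 r3 r4 r5 r6 by linarith
qed

lemma lead_even_3:
  assumes F0: "cusp_fun 1 F0" and F1: "cusp_fun 1 F1" and D0: "deg_less 4 F0" and L0: "lead 3 F0 F1"
  shows "F1 1 0 = 0"
proof -
  note s = cusp_fun_sign_simps[OF F0] cusp_fun_sign_simps[OF F1] fdiff_pow_expand fact_values
  note r0 = lead_eq[OF L0, of 1 1 "-1" 0, simplified s, simplified, simplified s, simplified]
  note r1 = line[OF D0, of "-2" "-2" 3 1, simplified s, simplified, simplified s, simplified]
  note r2 = line[OF D0, of 2 "-2" "-5" 1, simplified s, simplified, simplified s, simplified]
  note r3 = line[OF D0, of "-1" 3 2 "-2", simplified s, simplified, simplified s, simplified]
  note r4 = line[OF D0, of "-1" "-5" 2 2, simplified s, simplified, simplified s, simplified]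
  note r5 = cusp_line[OF F0, of "-9" 0 1 1 "-8" "-2" 3 "-5" 2, simplified s, simplified, simplified s, simplified]
  note r6 = cusp_line[OF F0, of "-1" "-1" "-9" 0 "-3" 5 "-8" "-2" 2, simplified s, simplified, simplified s, simplified]
  note r7 = line[OF D0, of 0 "-1" "-1" 1, simplified s, simplified, simplified s, simplified]
  note r8 = line[OF D0, of "-1" 1 2 "-1", simplified s, simplified, simplified s, simplified]
  note r9 = line[OF D0, of 1 1 "-3" 0, simplified s, simplified, simplified s, simplified]
  note r10 = line[OF D0, of "-1" "-1" 1 0, simplified s, simplified, simplified s, simplified]
  note r11 = line[OF D0, of 1 "-2" "-3" 1, simplified s, simplified, simplified s, simplified]
  note r12 = line[OF D0, of "-1" "-3" 2 1, simplified s, simplified, simplified s, simplified]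
  note r13 = line[OF D0, of "-1" "-2" 1 1, simplified s, simplified, simplified s, simplified]
  note r14 = line[OF D0, of 0 "-3" "-1" 1, simplified s, simplified, simplified s, simplified]
  note r15 = line[OF D0, of "-1" "-1" 2 0, simplified s, simplified, simplified s, simplified]
  show ?thesis using r0 r1 r2 r3 r4 r5 r6 r7 r8 r9 r10 r11 r12 r13 r14 r15 by linarith
qed

text \<open>Adds one weighted equation to a running sum, so that the long certificate below is
  evaluated with given weights instead of being searched for.\<close>

lemma lincomb: "x = (y::rat) \<Longrightarrow> u = v \<Longrightarrow> c * x + u = c * y + v"
  by simp

lemma lead_cube_even_4:
  assumes F0: "cusp_fun 1 F0"
    and F1: "cusp_fun 1 F1"
    and F2: "cusp_fun 1 F2"
    and F3: "cusp_fun 1 F3"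
    and L0: "lead 4 F0 F1"
    and L1: "lead 4 F1 F2"
    and L2: "lead 4 F2 F3"
  shows "F3 1 0 = F2 1 0"
proof -
  note s = cusp_fun_sign_simps[OF F0]
    cusp_fun_sign_simps[OF F1]
    cusp_fun_sign_simps[OF F2]
    cusp_fun_sign_simps[OF F3] fdiff_pow_expand fact_values
  \<comment> \<open>The sum starts at \<open>0 = 0\<close>. In the end all values of
    \<open>F0\<close> and \<open>F1\<close> and all other values of \<open>F2\<close> cancel,
    leaving a nonzero multiple of the claim.\<close>
  note t = refl[of "0 :: rat"]
  note t = lincomb[OF cusp_line[OF F0, of "-4" 2 9 1 "-3" "-12" 7 "-5" 2, simplified s, simplified, simplified s, simplified] t, of "-1"]
  note t = lincomb[OF cusp_line[OF F0, of "-5" "-2" "-9" 1 "-3" 8 "-5" "-5" 2, simplified s, simplified, simplified s, simplified] t, of 1]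
  note t = lincomb[OF cusp_line[OF F0, of "-5" "-3" "-7" 2 "-2" 7 "-3" "-5" 1, simplified s, simplified, simplified s, simplified] t, of 1]
  note t = lincomb[OF cusp_line[OF F0, of "-5" 3 8 2 "-2" "-8" 3 "-5" 1, simplified s, simplified, simplified s, simplified] t, of "-1"]
  note t = lincomb[OF cusp_line[OF F0, of "-4" 2 9 1 "-4" "-7" 9 "-3" 1, simplified s, simplified, simplified s, simplified] t, of 4]
  note t = lincomb[OF cusp_line[OF F0, of "-1" "-1" "-9" 0 "-5" 3 "-8" "-2" 2, simplified s, simplified, simplified s, simplified] t, of 2]
  note t = lincomb[OF cusp_line[OF F0, of "-3" "-3" 8 "-1" "-1" 7 4 2 1, simplified s, simplified, simplified s, simplified] t, of 6]
  note t = lincomb[OF cusp_line[OF F0, of "-2" 3 "-7" "-1" "-2" "-8" "-5" 3 1, simplified s, simplified, simplified s, simplified] t, of "-6"]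
  note t = lincomb[OF cusp_line[OF F0, of "-8" 1 9 1 "-3" "-7" 4 "-5" 2, simplified s, simplified, simplified s, simplified] t, of 2]
  note t = lincomb[OF cusp_line[OF F0, of "-5" "-2" "-9" 1 "-5" 3 "-8" "-2" 1, simplified s, simplified, simplified s, simplified] t, of "-4"]
  note t = lincomb[OF cusp_line[OF F0, of "-9" "-1" "-8" 1 "-4" 5 "-3" "-7" 2, simplified s, simplified, simplified s, simplified] t, of 4]
  note t = lincomb[OF cusp_line[OF F0, of 1 1 "-9" 0 "-1" "-7" "-3" 2 2, simplified s, simplified, simplified s, simplified] t, of "-2"]
  note t = lincomb[OF cusp_line[OF F0, of "-9" "-1" "-8" 1 "-8" 3 "-5" "-5" 2, simplified s, simplified, simplified s, simplified] t, of 2]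
  note t = lincomb[OF cusp_line[OF F0, of "-5" "-2" "-9" 1 "-4" 5 "-7" "-3" 1, simplified s, simplified, simplified s, simplified] t, of "-12"]
  note t = lincomb[OF cusp_line[OF F0, of "-9" "-1" "-4" 2 "-7" 2 "-3" "-5" 1, simplified s, simplified, simplified s, simplified] t, of "-22"]
  note t = lincomb[OF cusp_line[OF F0, of "-9" 1 5 2 "-7" "-3" 4 "-5" 1, simplified s, simplified, simplified s, simplified] t, of 2]
  note t = lincomb[OF cusp_line[OF F0, of "-1" "-1" "-9" 0 "-8" 1 "-9" "-1" 1, simplified s, simplified, simplified s, simplified] t, of "-24"]
  note t = lincomb[OF cusp_line[OF F0, of "-5" "-2" 9 "-1" "-3" 5 8 2 1, simplified s, simplified, simplified s, simplified] t, of "-8"]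
  note t = lincomb[OF cusp_line[OF F0, of 1 1 "-9" 0 "-2" "-4" "-7" 1 1, simplified s, simplified, simplified s, simplified] t, of 24]
  note t = lincomb[OF cusp_line[OF F0, of "-8" 1 9 1 "-7" "-4" 9 "-3" 1, simplified s, simplified, simplified s, simplified] t, of "-2"]
  note t = lincomb[OF cusp_line[OF F0, of "-8" 1 9 1 "-5" "-3" 7 "-2" 1, simplified s, simplified, simplified s, simplified] t, of "-8"]
  note t = lincomb[OF cusp_line[OF F0, of "-8" 1 "-9" "-1" "-7" "-3" "-5" 4 1, simplified s, simplified, simplified s, simplified] t, of "-16"]
  note t = lincomb[OF cusp_line[OF F0, of "-9" 0 1 1 "-9" "-1" 4 "-2" 1, simplified s, simplified, simplified s, simplified] t, of 52]
  note t = lincomb[OF cusp_line[OF F0, of "-9" 0 1 1 "-7" "-1" 2 "-3" 1, simplified s, simplified, simplified s, simplified] t, of "-12"]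
  note t = lincomb[OF cusp_line[OF F0, of "-9" "-1" "-8" 1 "-9" 1 "-5" "-2" 1, simplified s, simplified, simplified s, simplified] t, of "-14"]
  note t = lincomb[OF cusp_line[OF F0, of "-9" "-1" "-8" 1 "-7" 2 "-5" "-3" 1, simplified s, simplified, simplified s, simplified] t, of "-60"]
  note t = lincomb[OF cusp_line[OF F0, of "-1" "-1" "-9" 0 "-4" 2 "-9" "-1" 1, simplified s, simplified, simplified s, simplified] t, of 8]
  note t = lincomb[OF cusp_line[OF F0, of 1 1 "-9" 0 "-3" "-3" "-8" 1 1, simplified s, simplified, simplified s, simplified] t, of 32]
  note t = lincomb[OF lead_eq[OF L2, of 1 1 "-2" 0, simplified s, simplified, simplified s, simplified] t, of "-576"]
  note t = lincomb[OF lead_eq[OF L1, of 1 "-2" "-3" 1, simplified s, simplified, simplified s, simplified] t, of 96]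
  note t = lincomb[OF lead_eq[OF L1, of 0 "-2" "-1" 1, simplified s, simplified, simplified s, simplified] t, of "-144"]
  note t = lincomb[OF lead_eq[OF L1, of 2 2 "-3" "-1", simplified s, simplified, simplified s, simplified] t, of "-24"]
  note t = lincomb[OF lead_eq[OF L1, of 1 3 "-2" "-1", simplified s, simplified, simplified s, simplified] t, of 96]
  note t = lincomb[OF lead_eq[OF L1, of 2 "-2" "-5" 1, simplified s, simplified, simplified s, simplified] t, of "-24"]
  note t = lincomb[OF lead_eq[OF L1, of 1 1 "-2" 0, simplified s, simplified, simplified s, simplified] t, of 576]
  note t = lincomb[OF lead_eq[OF L0, of 3 2 "-5" "-1", simplified s, simplified, simplified s, simplified] t, of 4]
  note t = lincomb[OF lead_eq[OF L0, of 5 "-3" "-8" 2, simplified s, simplified, simplified s, simplified] t, of "-1"]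
  note t = lincomb[OF lead_eq[OF L0, of 3 "-2" "-7" 1, simplified s, simplified, simplified s, simplified] t, of 4]
  note t = lincomb[OF lead_eq[OF L0, of 2 2 "-3" "-1", simplified s, simplified, simplified s, simplified] t, of 28]
  note t = lincomb[OF lead_eq[OF L0, of 1 "-3" "-2" 2, simplified s, simplified, simplified s, simplified] t, of "-2"]
  note t = lincomb[OF lead_eq[OF L0, of 5 5 "-12" "-2", simplified s, simplified, simplified s, simplified] t, of "-1"]
  note t = lincomb[OF lead_eq[OF L0, of 1 1 "-2" 0, simplified s, simplified, simplified s, simplified] t, of "-40"]
  note t = lincomb[OF lead_eq[OF L0, of 3 5 "-7" "-2", simplified s, simplified, simplified s, simplified] t, of "-1"]
  note t = lincomb[OF lead_eq[OF L0, of 1 3 "-2" "-1", simplified s, simplified, simplified s, simplified] t, of "-68"]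
  note t = lincomb[OF lead_eq[OF L0, of 2 "-2" "-5" 1, simplified s, simplified, simplified s, simplified] t, of 8]
  note t = lincomb[OF lead_eq[OF L0, of 1 5 "-2" "-2", simplified s, simplified, simplified s, simplified] t, of "-22"]
  note t = lincomb[OF lead_eq[OF L0, of 2 5 "-3" "-3", simplified s, simplified, simplified s, simplified] t, of 4]
  note t = lincomb[OF lead_eq[OF L0, of 1 "-2" "-3" 1, simplified s, simplified, simplified s, simplified] t, of "-68"]
  note t = lincomb[OF lead_eq[OF L0, of 3 "-3" "-5" 2, simplified s, simplified, simplified s, simplified] t, of 3]
  note t = lincomb[OF lead_eq[OF L0, of 0 "-2" "-1" 1, simplified s, simplified, simplified s, simplified] t, of 152]
  from t show ?thesis by simp
qed

subsection \<open>Homogeneous functions are binary forms\<close>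

text \<open>The Leibniz rule for a product with a linear factor, whose higher differences
  vanish.\<close>

lemma fdiff_pow_mult_linear:
  fixes f :: "int \<Rightarrow> 'a::comm_ring_1"
  shows "(fdiff ^^ Suc k) (\<lambda>n. (b + of_int n * a) * f n) n =
    (b + of_int n * a) * (fdiff ^^ Suc k) f n + of_nat (Suc k) * a * (fdiff ^^ k) f (n + 1)"
proof (induction k arbitrary: n)
  case (Suc k)
  have step: "(fdiff ^^ Suc m) g n = (fdiff ^^ m) g (n + 1) - (fdiff ^^ m) g n" for m n and g :: "int \<Rightarrow> 'a"
    by (simp add: fdiff_def)
  show ?case
    unfolding step[of "Suc k" "\<lambda>n. (b + of_int n * a) * f n"] Suc.IH
    unfolding step by (simp add: algebra_simps)
qed (simp add: fdiff_def algebra_simps)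

text \<open>Linear factors are split off one at a time. In the Leibniz rule the term with the
  undifferentiated linear factor drops out, because the remaining product has too small a
  degree.\<close>

lemma fdiff_pow_form:
  fixes a b c d :: rat
  shows "(fdiff ^^ (i + j)) (\<lambda>n. (b + of_int n * a) ^ i * (d + of_int n * c) ^ j) n = fact (i + j) * a ^ i * c ^ j"
proof (induction i arbitrary: n)
  case 0
  have "(fdiff ^^ j) (\<lambda>n. (d + of_int n * c) ^ j) n = fact j * c ^ j" for n
  proof (induction j arbitrary: n)
    case (Suc j)
    have z: "(fdiff ^^ Suc j) (\<lambda>n. (d + of_int n * c) ^ j) n = 0" for n
      by (simp add: fdiff_def[of "(fdiff ^^ j) g" for g] Suc.IH)
    show ?case
      unfolding power_Suc fdiff_pow_mult_linear z Suc.IH by (simp add: algebra_simps)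
  qed simp
  then show ?case by simp
next
  case (Suc i)
  let ?f = "\<lambda>n. (b + of_int n * a) ^ i * (d + of_int n * c) ^ j"
  have z: "(fdiff ^^ Suc (i + j)) ?f n = 0" for n
    by (simp add: fdiff_def[of "(fdiff ^^ (i + j)) g" for g] Suc.IH)
  show ?case
    unfolding power_Suc mult.assoc add_Suc fdiff_pow_mult_linear z Suc.IH by (simp add: algebra_simps)
qed

lemma fdiff_pow_form_zero:
  fixes a b c d :: rat
  assumes "i + j < m"
  shows "(fdiff ^^ m) (\<lambda>n. (b + of_int n * a) ^ i * (d + of_int n * c) ^ j) n = 0"
proof -
  obtain r where m: "m = r + Suc (i + j)" using assms by (metis add.commute less_iff_Suc_add add_Suc_right)
  have "(fdiff ^^ Suc (i + j)) (\<lambda>n. (b + of_int n * a) ^ i * (d + of_int n * c) ^ j) = (\<lambda>n. 0)"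
    by (rule ext) (simp add: fdiff_def[of "(fdiff ^^ (i + j)) g" for g] fdiff_pow_form)
  moreover have "(fdiff ^^ r) (\<lambda>n. 0) = (\<lambda>n. 0 :: rat)"
    by (induction r) (simp_all add: fdiff_def fun_eq_iff)
  ultimately show ?thesis unfolding m funpow_add o_apply by simp
qed

definition form :: "nat \<Rightarrow> (nat \<Rightarrow> 'a) \<Rightarrow> 'a \<Rightarrow> 'a \<Rightarrow> 'a::comm_ring_1" where
  "form k K x y = (\<Sum>i\<le>k. K i * (x ^ i * y ^ (k - i)))"

lemma fdiff_pow_sum:
  fixes f :: "'b \<Rightarrow> int \<Rightarrow> 'a::comm_ring_1"
  shows "(fdiff ^^ m) (\<lambda>n. \<Sum>i\<in>S. f i n) n = (\<Sum>i\<in>S. (fdiff ^^ m) (f i) n)"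
  by (induction m arbitrary: n) (simp_all add: fdiff_def sum_subtractf)

lemma fdiff_form:
  fixes K :: "nat \<Rightarrow> rat"
  shows "(fdiff ^^ k) (\<lambda>n. form k K (b + of_int n * a) (d + of_int n * c)) n = fact k * form k K a c"
  unfolding form_def fdiff_pow_sum fdiff_pow_mult sum_distrib_left
proof (rule sum.cong[OF refl])
  fix i assume "i \<in> {..k}"
  then show "K i * (fdiff ^^ k) (\<lambda>n. (b + of_int n * a) ^ i * (d + of_int n * c) ^ (k - i)) n =
      fact k * (K i * (a ^ i * c ^ (k - i)))"
    using fdiff_pow_form[where i = i and j = "k - i"] by simp
qed

lemma fdiff_form_zero:
  fixes K :: "nat \<Rightarrow> rat"
  assumes "k < m"
  shows "(fdiff ^^ m) (\<lambda>n. form k K (b + of_int n * a) (d + of_int n * c)) n = 0"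
  unfolding form_def fdiff_pow_sum fdiff_pow_mult
  by (rule sum.neutral) (use assms in \<open>simp add: fdiff_pow_form_zero\<close>)

text \<open>The functions of parity \<open>(- 1) ^ k\<close> fixed by the leading coefficient
  operator. For \<open>k \<le> 4\<close> they turn out to be exactly the binary forms of degree
  \<open>k\<close>, restricted to primitive vectors.\<close>

definition hom_fun :: "nat \<Rightarrow> (int \<Rightarrow> int \<Rightarrow> rat) \<Rightarrow> bool" where
  "hom_fun k F \<longleftrightarrow> cusp_fun ((- 1) ^ k) F \<and> lead k F F"

lemma hom_fun_form:
  assumes "k \<le> 4"
  shows "hom_fun k (\<lambda>x y. form k K (of_int x) (of_int y))"
proof -
  have sg: "form k K (- of_int x) (- of_int y) = (- 1) ^ k * form k K (of_int x) (of_int y)" for x y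
  proof -
    have "(- of_int x) ^ i * (- of_int y) ^ (k - i) = (- 1) ^ k * (of_int x ^ i * of_int y ^ (k - i) :: rat)"
      if "i \<le> k" for i
    proof -
      have "(- 1) ^ k = ((- 1) ^ i * (- 1) ^ (k - i) :: rat)" using that by (simp flip: power_add)
      then show ?thesis
        using power_minus[of "of_int x :: rat" i] power_minus[of "of_int y :: rat" "k - i"] by simp
    qed
    then show ?thesis
      unfolding form_def sum_distrib_left by (intro sum.cong) (simp_all add: algebra_simps)
  qed
  have f5: "(fdiff ^^ 5) (\<lambda>n. form k K (of_int (b + n * m * a)) (of_int (d + n * m * c))) 0 = 0" for a b c d m
    using fdiff_form_zero[of k 5 K "of_int b" "of_int (m * a)" "of_int d" "of_int (m * c)" 0] assms
    by (simp add: mult.assoc)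
  have ld: "(fdiff ^^ k) (\<lambda>n. form k K (of_int (b + n * a)) (of_int (d + n * c))) 0 =
      fact k * form k K (of_int a) (of_int c)" for a b c d
    using fdiff_form[of k K "of_int b" "of_int a" "of_int d" "of_int c" 0] by simp
  show ?thesis
    unfolding hom_fun_def cusp_fun_def lead_def of_int_minus
    by (intro conjI allI impI; rule sg f5 ld)
qed

lemma hom_fun_diff:
  assumes "hom_fun k F" "hom_fun k G"
  shows "hom_fun k (\<lambda>x y. F x y - G x y)"
  using assms by (simp add: hom_fun_def cusp_fun_def lead_def fdiff_pow_diff algebra_simps)

text \<open>Substitution by a matrix of determinant one maps lines to lines and preserves
  coprimality and the determinant of base point and direction, and the conditions mention nothing
  else.\<close>

lemma hom_fun_comp:
  assumes F: "hom_fun k F" and det: "p * s - q * r = 1"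
  shows "hom_fun k (\<lambda>x y. F (p * x + q * y) (r * x + s * y))"
proof -
  have copr: "coprime (p * a + q * c) (r * a + s * c)" if ac: "coprime a c" for a c
  proof -
    obtain b d where "a * d - b * c = 1" using ex_SL2Z_column[OF ac] by blast
    then have "(p * a + q * c) * (r * b + s * d) - (p * b + q * d) * (r * a + s * c) = 1"
      using det by algebra
    then show ?thesis by (rule SL2Z_column_coprime)
  qed
  have lin: "p * (b + m * a) + q * (d + m * c) = (p * b + q * d) + m * (p * a + q * c)"
    "r * (b + m * a) + s * (d + m * c) = (r * b + s * d) + m * (r * a + s * c)" for a b c d m
    by (simp_all add: algebra_simps)
  have m: "(p * a + q * c) * (r * b + s * d) - (p * b + q * d) * (r * a + s * c) = a * d - b * c" for a b c d
    using det by algebra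
  show ?thesis
    unfolding hom_fun_def cusp_fun_def lead_def lin
  proof (intro conjI allI impI)
    fix x y
    have "F (- (p * x + q * y)) (- (r * x + s * y)) = (- 1) ^ k * F (p * x + q * y) (r * x + s * y)"
      by (rule cusp_fun_sign[OF conjunct1[OF F[unfolded hom_fun_def]]])
    then show "F (p * (- x) + q * (- y)) (r * (- x) + s * (- y)) = (- 1) ^ k * F (p * x + q * y) (r * x + s * y)"
      by (simp add: algebra_simps)
  next
    fix a b c d :: int
    assume "coprime a c" "coprime b d"
    then have "(fdiff ^^ 5) (\<lambda>n. F ((p * b + q * d) + n * (a * d - b * c) * (p * a + q * c))
        ((r * b + s * d) + n * (a * d - b * c) * (r * a + s * c))) 0 = 0"
      using F copr[of a c] copr[of b d] unfolding hom_fun_def cusp_fun_def m[of a c b d, symmetric] by simp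
    then show "(fdiff ^^ 5) (\<lambda>n. F (p * b + q * d + n * (a * d - b * c) * (p * a + q * c))
        (r * b + s * d + n * (a * d - b * c) * (r * a + s * c))) 0 = 0" .
  next
    fix a b c d :: int
    assume "a * d - b * c = 1"
    then show "(fdiff ^^ k) (\<lambda>n. F (p * b + q * d + n * (p * a + q * c)) (r * b + s * d + n * (r * a + s * c))) 0
      = fact k * F (p * a + q * c) (r * a + s * c)"
      using lead_eq[of k F F "p * a + q * c" "r * b + s * d" "p * b + q * d" "r * a + s * c"] F
      by (simp only: hom_fun_def m)
  qed
qed

lemma lead_shift:
  assumes "lead k F G" "a * d - b * c = 1"
  shows "(fdiff ^^ k) (\<lambda>n. F (b + n * a) (d + n * c)) m = fact k * G a c"
proof -
  have "a * (d + m * c) - (b + m * a) * c = 1" using assms(2) by algebra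
  from lead_eq[OF assms(1) this]
  show ?thesis using fdiff_pow_shift[of k "\<lambda>n. F (b + n * a) (d + n * c)" m 0]
    by (simp add: algebra_simps)
qed

text \<open>The \<open>k\<close>-th difference of \<open>n \<mapsto> F (- 1) n\<close> is
  \<open>k!\<close> times \<open>F 0 1 = 0\<close>, so its degree is below \<open>k\<close> and
  \<open>k\<close> consecutive zeros suffice. Those at -1, 0, 1 follow from the hypotheses and the
  sign rule.\<close>

lemma hom_fun_zero_on_line:
  assumes F: "hom_fun k F" and k: "k \<le> 4" and 0: "F 1 0 = 0" "\<And>n. F n 1 = 0"
  shows "F (- 1) n = 0"
proof -
  have L: "lead k F F" and C: "cusp_fun ((- 1) ^ k) F" using F by (simp_all add: hom_fun_def)
  note sgn = cusp_fun_sign[OF C]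
  have small: "F (- 1) (- 1) = 0" "F (- 1) 0 = 0" "F (- 1) 1 = 0"
    using 0 sgn[of 1 1] sgn[of 1 0] by simp_all
  \<comment> \<open>For \<open>k = 4\<close> a fourth zero is needed, at \<open>(-1, 2)\<close>,
    which neither the hypotheses nor the sign rule provide.\<close>
  have two: "F (- 1) 2 = 0" if "k = 4"
  proof -
    have L4: "lead 4 F F" and C4: "cusp_fun 1 F" using L C that by simp_all
    \<comment> \<open>On the line through \<open>(1, 0)\<close> with direction
      \<open>(- j, - 1)\<close>, the three middle ones of five consecutive points are known zeros
      and the leading coefficient vanishes, so the two end values add up to zero.\<close>
    have alt: "F (2 * j + 1) 2 = - F (2 * j - 1) 2" for j
    proof -
      have "(fdiff ^^ 4) (\<lambda>m. F (1 + m * (- j)) (0 + m * (- 1))) (- 2) = fact 4 * F (- j) (- 1)"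
        by (rule lead_shift[OF L4]) simp
      moreover have "F (- j) (- 1) = 0" "F (1 - j) (- 1) = 0"
        using 0 cusp_fun_sign[OF C4, of j 1] cusp_fun_sign[OF C4, of "j - 1" 1] by simp_all
      ultimately have "F (1 + 2 * j) 2 + F (1 - 2 * j) (- 2) = 0"
        unfolding fdiff_pow_expand using 0 by simp
      moreover have "F (1 - 2 * j) (- 2) = F (2 * j - 1) 2"
        using cusp_fun_sign[OF C4, of "2 * j - 1" 2] by simp
      moreover have "F (2 * j + 1) 2 = F (1 + 2 * j) 2"
        by (simp only: add.commute)
      ultimately show ?thesis by linarith
    qed
    \<comment> \<open>A fifth difference along a line of determinant 2. As the values alternate in
      sign, all binomial coefficients add up and the relation reads
      \<open>- 32 * F (- 1) 2 = 0\<close>.\<close>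
    have "F 9 2 - 5 * F 7 2 + 10 * F 5 2 - 10 * F 3 2 + 5 * F 1 2 - F (- 1) 2 = 0"
      using cusp_line[OF C4, of 1 1 0 0 "- 1" "- 1" 0 2 2] by simp
    moreover have "F 1 2 = - F (- 1) 2" "F 3 2 = - F 1 2" "F 5 2 = - F 3 2" "F 7 2 = - F 5 2" "F 9 2 = - F 7 2"
      using alt[of 0] alt[of 1] alt[of 2] alt[of 3] alt[of 4] by simp_all
    ultimately show ?thesis by linarith
  qed
  show ?thesis
  proof (rule fdiff_pow_zero_unique[where f = "F (- 1)" and d = k and a = "- 1"])
    show "(fdiff ^^ k) (F (- 1)) m = 0" for m
      using lead_shift[OF L, of 0 0 "- 1" 1 m] 0 by simp
    show "F (- 1) (- 1 + int j) = 0" if "j < k" for j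
    proof -
      have "j = 0 \<or> j = 1 \<or> j = 2 \<or> (j = 3 \<and> k = 4)" using that k by linarith
      then show ?thesis using small two by auto
    qed
  qed
qed

text \<open>The Euclidean algorithm: a unimodular substitution carries \<open>(x, y)\<close> to a
  vector whose second coordinate is the negative remainder, and the transformed function satisfies
  the same hypotheses.\<close>

lemma hom_fun_zero:
  assumes "hom_fun k F" "k \<le> 4" "F 1 0 = 0" "\<And>n. F n 1 = 0" "coprime x y"
  shows "F x y = 0"
  using assms
proof (induction "nat \<bar>y\<bar>" arbitrary: F x y rule: less_induct)
  case less
  show ?case
  proof (cases "y = 0")
    case True
    then have "x = 1 \<or> x = - 1" using less.prems(5) by auto
    moreover have "F (- 1) 0 = 0" using less.prems hom_fun_zero_on_line by blast
    ultimately show ?thesis using True less.prems(3) by auto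
  next
    case False
    define r where "r = x mod y"
    define m where "m = x div y"
    have x: "x = m * y + r" by (simp add: r_def m_def)
    \<comment> \<open>\<open>?G\<close> takes at \<open>(y, - r)\<close> the value of
      \<open>F\<close> at \<open>(m y + r, y) = (x, y)\<close>.\<close>
    let ?G = "\<lambda>x y. F (m * x + (- 1) * y) (1 * x + 0 * y)"
    have "?G y (- r) = 0"
    proof (rule less.hyps[of "- r" ?G y])
      show "nat \<bar>- r\<bar> < nat \<bar>y\<bar>" using abs_mod_less[OF False, of x] by (simp add: r_def)
      show "hom_fun k ?G" using less.prems(1) by (rule hom_fun_comp) simp
      show "k \<le> 4" by fact
      show "?G 1 0 = 0" using less.prems(4) by simp
      show "?G n 1 = 0" for n
      proof -
        \<comment> \<open>The values \<open>?G n 1\<close> are those of the sheared function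
          \<open>?H\<close> on the line \<open>x = -1\<close>. The shear permutes the points of the
          line \<open>y = 1\<close> and fixes \<open>(1, 0)\<close>.\<close>
        let ?H = "\<lambda>x y. F (1 * x + m * y) (0 * x + 1 * y)"
        have "hom_fun k ?H" using less.prems(1) by (rule hom_fun_comp) simp
        from hom_fun_zero_on_line[OF this less.prems(2), of n] less.prems(3,4)
        show ?thesis by (simp add: algebra_simps)
      qed
      show "coprime y (- r)"
        using less.prems(5) by (simp add: r_def coprime_mod_right_iff False coprime_commute)
    qed
    then show ?thesis using x by (simp add: algebra_simps)
  qed
qed

section \<open>Interpolation at \<open>k + 1\<close> primitive vectors\<close>

definition node :: "nat \<Rightarrow> nat \<Rightarrow> int \<times> int" where
  "node k j = (if j = k then (1, 0) else (int j - 1, 1))"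

text \<open>The nodes are \<open>(1, 0)\<close> and the \<open>k\<close> consecutive points
  \<open>(-1, 1), ..., (k - 2, 1)\<close>. A zero at \<open>(1, 0)\<close> lowers the degree along
  \<open>y = 1\<close> below \<open>k\<close>, so the others force \<open>F\<close> to vanish on
  that line.\<close>

lemma hom_fun_zero_nodes:
  assumes "hom_fun k F" "k \<le> 4" "\<And>j. j \<le> k \<Longrightarrow> F (fst (node k j)) (snd (node k j)) = 0" "coprime x y"
  shows "F x y = 0"
proof (rule hom_fun_zero[OF assms(1,2) _ _ assms(4)])
  show 10: "F 1 0 = 0" using assms(3)[of k] by (simp add: node_def)
  show "F n 1 = 0" for n
  proof (rule fdiff_pow_zero_unique[where f = "\<lambda>n. F n 1" and d = k and a = "- 1"])
    show "(fdiff ^^ k) (\<lambda>n. F n 1) m = 0" for m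
      using lead_shift[of k F F 1 1 0 0 m] assms(1) 10 by (simp add: hom_fun_def)
    show "F (- 1 + int j) 1 = 0" if "j < k" for j
      using assms(3)[of j] that by (simp add: node_def)
  qed
qed

text \<open>Each explicit matrix inverts the matrix of values of the monomials at the nodes; row
  \<open>i\<close> gives the coefficient of \<open>X^i Y^(k - i)\<close>.\<close>

lemma interpolation:
  assumes "k \<le> 4"
  shows "\<exists>A :: nat \<Rightarrow> nat \<Rightarrow> rat. \<forall>f :: nat \<Rightarrow> rat. \<forall>j\<le>k.
    form k (\<lambda>i. \<Sum>l\<le>k. A i l * f l) (of_int (fst (node k j))) (of_int (snd (node k j))) = f j"
proof -
  let ?A = "\<lambda>M :: rat list list. \<lambda>i l. (M ! i) ! l"
  consider "k = 0" | "k = 1" | "k = 2" | "k = 3" | "k = 4" using assms by linarith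
  then show ?thesis
  proof cases
    case 1
    then show ?thesis by (intro exI[of _ "?A [[1]]"]) (simp add: form_def node_def)
  next
    case 2
    then show ?thesis
      by (intro exI[of _ "?A [[1, 1], [0, 1]]"])
        (auto simp: form_def node_def le_Suc_eq atMost_Suc numeral_eq_Suc)
  next
    case 3
    then show ?thesis
      by (intro exI[of _ "?A [[0, 1, 0], [-1, 1, 1], [0, 0, 1]]"])
        (auto simp: form_def node_def le_Suc_eq atMost_Suc numeral_eq_Suc)
  next
    case 4
    then show ?thesis
      by (intro exI[of _ "?A [[0, 1, 0, 0], [-1/2, 0, 1/2, -1], [1/2, -1, 1/2, 0], [0, 0, 0, 1]]"])
        (auto simp: form_def node_def le_Suc_eq atMost_Suc numeral_eq_Suc)
  next
    case 5
    then show ?thesis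
      by (intro exI[of _ "?A [[0, 1, 0, 0, 0], [-1/3, -1/2, 1, -1/6, 2], [1/2, -1, 1/2, 0, -1],
          [-1/6, 1/2, -1/2, 1/6, -2], [0, 0, 0, 0, 1]]"])
        (auto simp: form_def node_def le_Suc_eq atMost_Suc numeral_eq_Suc)
  qed
qed

text \<open>The difference of \<open>F\<close> and its interpolating form vanishes at the nodes,
  hence everywhere. That \<open>A\<close> is independent of \<open>F\<close> matters: it will
  provide coefficients in the module that serve all functionals at once.\<close>

lemma hom_fun_eq_form:
  assumes "k \<le> 4"
  obtains A :: "nat \<Rightarrow> nat \<Rightarrow> rat" where
    "\<And>F x y. hom_fun k F \<Longrightarrow> coprime x y \<Longrightarrow>
      F x y = form k (\<lambda>i. \<Sum>l\<le>k. A i l * F (fst (node k l)) (snd (node k l))) (of_int x) (of_int y)"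
proof -
  obtain A :: "nat \<Rightarrow> nat \<Rightarrow> rat" where A: "\<And>f j. j \<le> k \<Longrightarrow>
    form k (\<lambda>i. \<Sum>l\<le>k. A i l * f l) (of_int (fst (node k j))) (of_int (snd (node k j))) = f j"
    using interpolation[OF assms] by blast
  show ?thesis
  proof (rule that[of A])
    fix F x y assume F: "hom_fun k F" and xy: "coprime (x::int) y"
    let ?K = "\<lambda>i. \<Sum>l\<le>k. A i l * F (fst (node k l)) (snd (node k l))"
    have "F x y - form k ?K (of_int x) (of_int y) = 0"
      by (rule hom_fun_zero_nodes[OF hom_fun_diff[OF F hom_fun_form[OF assms]] assms _ xy]) (simp add: A)
    then show "F x y = form k ?K (of_int x) (of_int y)" by simp
  qed
qed

lemma poly_nat_zero:
  fixes a :: "nat \<Rightarrow> rat"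
  assumes "\<And>n::nat. (\<Sum>i\<le>k. a i * of_nat n ^ i) = 0" "i \<le> k"
  shows "a i = 0"
proof -
  define p where "p = (\<Sum>i\<le>k. monom (a i) i)"
  have "poly p (of_nat n) = 0" for n :: nat
    using assms(1)[of n] by (simp add: p_def poly_sum poly_monom)
  then have "range (of_nat :: nat \<Rightarrow> rat) \<subseteq> {x. poly p x = 0}" by auto
  moreover have "infinite (range (of_nat :: nat \<Rightarrow> rat))"
    by (rule range_inj_infinite) (simp add: inj_on_def)
  ultimately have "p = 0" using poly_roots_finite finite_subset by blast
  then have "coeff p i = 0" by simp
  then show ?thesis using assms(2) by (simp add: p_def coeff_sum)
qed

lemma fdiff_pow_additive:
  assumes "\<And>x y. f (x - y) = f x - f y"
  shows "f ((fdiff ^^ k) s n) = (fdiff ^^ k) (\<lambda>n. f (s n)) n"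
  by (induction k arbitrary: n) (simp_all add: fdiff_def assms)

subsection \<open>Modules and sums of symmetric powers\<close>

locale sl2_module =
  fixes smul :: "rat \<Rightarrow> 'v::ab_group_add \<Rightarrow> 'v" and act :: "int^2^2 \<Rightarrow> 'v \<Rightarrow> 'v"
  assumes mod: "QSL2_module smul act"
begin

sublocale V: vector_space smul
  using mod by (simp add: QSL2_module_def)

lemma act_linear: "g \<in> SL2Z \<Longrightarrow> Vector_Spaces.linear smul smul (act g)"
  using mod by (simp add: QSL2_module_def)

lemma act_simps:
  assumes "g \<in> SL2Z"
  shows act_add: "act g (x + y) = act g x + act g y" and act_smul: "act g (smul r x) = smul r (act g x)"
    and act_diff: "act g (x - y) = act g x - act g y" and act_zero: "act g 0 = 0"
proof -
  interpret module_hom smul smul "act g"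
    using act_linear[OF assms] by (simp add: linear_iff_module_hom)
  show "act g (x + y) = act g x + act g y" "act g (smul r x) = smul r (act g x)"
    "act g (x - y) = act g x - act g y" "act g 0 = 0"
    by (simp_all add: add scale diff zero)
qed

lemma act_one: "act (mat2 1 0 0 1) x = x"
  using mod by (simp add: QSL2_module_def mat_1_mat2)

lemma act_act: "g \<in> SL2Z \<Longrightarrow> h \<in> SL2Z \<Longrightarrow> act g (act h x) = act (g ** h) x"
  using mod by (simp add: QSL2_module_def)

abbreviation submod :: "'v set \<Rightarrow> bool" where
  "submod \<equiv> submodule smul act"

lemma submod_subspace: "submod U \<Longrightarrow> V.subspace U"
  and submod_act: "submod U \<Longrightarrow> g \<in> SL2Z \<Longrightarrow> x \<in> U \<Longrightarrow> act g x \<in> U"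
  by (simp_all add: submodule_def)

section \<open>Functionals vanishing on a submodule\<close>

definition annihilator :: "'v set \<Rightarrow> ('v \<Rightarrow> rat) set" where
  "annihilator U = {f. Vector_Spaces.linear smul (*) f \<and> (\<forall>x\<in>U. f x = 0)}"

lemma annihilatorD:
  assumes "f \<in> annihilator U"
  shows "f (x + y) = f x + f y" "f (smul r x) = r * f x" "f (x - y) = f x - f y" "f 0 = 0"
    "f (- x) = - f x" "f (sum h S) = (\<Sum>i\<in>S. f (h i))" "x \<in> U \<Longrightarrow> f x = 0"
proof -
  interpret module_hom smul "(*)" f
    using assms by (simp add: annihilator_def linear_iff_module_hom)
  show "f (x + y) = f x + f y" "f (smul r x) = r * f x" "f (x - y) = f x - f y" "f 0 = 0"
    "f (- x) = - f x" "f (sum h S) = (\<Sum>i\<in>S. f (h i))"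
    by (simp_all add: add scale diff zero neg sum)
qed (use assms in \<open>simp add: annihilator_def\<close>)

lemma annihilator_diff: "f \<in> annihilator U \<Longrightarrow> x - y \<in> U \<Longrightarrow> f x = f y"
  using annihilatorD(3,7)[of f U] by fastforce

lemma annihilatorI:
  assumes "\<And>x y. f (x + y) = f x + f y" "\<And>r x. f (smul r x) = r * f x" "\<And>x. x \<in> U \<Longrightarrow> f x = 0"
  shows "f \<in> annihilator U"
proof -
  have "Vector_Spaces.linear smul (*) f"
    unfolding linear_iff_module_hom module_hom_iff
    using assms V.module_axioms vector_space_over_itself.module_axioms by blast
  with assms show ?thesis by (simp add: annihilator_def)
qed

text \<open>If \<open>x\<close> were outside \<open>U\<close>, a basis of \<open>U\<close> together
  with \<open>x\<close> would extend to a basis of the whole space, and the coordinate at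
  \<open>x\<close> would be a functional contradicting the hypothesis. Membership in
  \<open>U\<close> can thus be tested by rational-valued functions.\<close>

lemma subspace_separation:
  assumes U: "V.subspace U" and f: "\<And>f. f \<in> annihilator U \<Longrightarrow> f x = 0"
  shows "x \<in> U"
proof (rule ccontr)
  assume x: "x \<notin> U"
  obtain A where A: "A \<subseteq> U" "V.independent A" "U \<subseteq> V.span A"
    using V.maximal_independent_subset by blast
  have sA: "V.span A = U" using A U by (simp add: V.span_subspace)
  then have ind: "V.independent (insert x A)" using A(2) x V.independent_insertI by simp
  define g where "g = V.representation (V.extend_basis (insert x A))"
  have ext: "V.independent (V.extend_basis (insert x A))" "V.span (V.extend_basis (insert x A)) = UNIV"
    "insert x A \<subseteq> V.extend_basis (insert x A)"
    using ind V.independent_extend_basis V.span_extend_basis V.extend_basis_superset by blast+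
  have "(\<lambda>y. g y x) \<in> annihilator U"
  proof (rule annihilatorI)
    show "g (y + z) x = g y x + g z x" for y z
      unfolding g_def using ext by (simp add: V.representation_add)
    show "g (smul r y) x = r * g y x" for r y
      unfolding g_def using ext by (simp add: V.representation_scale)
    show "g y x = 0" if "y \<in> U" for y
    proof -
      have "V.representation (V.extend_basis (insert x A)) y = V.representation A y"
        using that sA ext by (intro V.representation_extend) auto
      moreover have "x \<notin> A" using A x by blast
      ultimately show ?thesis unfolding g_def by (metis V.representation_ne_zero)
    qed
  qed
  moreover have "g x x = 1" unfolding g_def using ext by (simp add: V.representation_basis)
  ultimately show False using f by fastforce
qed

section \<open>Powers of \<open>g - 1\<close> as iterated differences\<close>

definition dlt :: "int^2^2 \<Rightarrow> 'v \<Rightarrow> 'v" where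
  "dlt g x = act g x - x"

text \<open>Along an orbit \<open>s n = g^n (s 0)\<close> the operator \<open>g - 1\<close> acts as
  the difference operator, because \<open>g\<close> commutes with forming differences.\<close>

lemma dlt_pow_fdiff:
  assumes "g \<in> SL2Z" "\<And>n. s (n + 1) = act g (s n)"
  shows "(dlt g ^^ k) (s n) = (fdiff ^^ k) s n"
proof (induction k)
  case (Suc k)
  have "act g ((fdiff ^^ k) s n) = (fdiff ^^ k) (\<lambda>n. act g (s n)) n"
    by (rule fdiff_pow_additive) (simp add: act_diff assms(1))
  also have "\<dots> = (fdiff ^^ k) s (n + 1)"
    by (simp add: assms(2)[symmetric] fdiff_pow_shift)
  finally show ?case using Suc by (simp add: dlt_def[of g "(fdiff ^^ k) s n"] fdiff_def[of "(fdiff ^^ k) s"])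
qed simp

lemma dlt_pow_linear:
  assumes "g \<in> SL2Z"
  shows "(dlt g ^^ k) (x + y) = (dlt g ^^ k) x + (dlt g ^^ k) y"
    "(dlt g ^^ k) (smul r x) = smul r ((dlt g ^^ k) x)"
  by (induction k) (simp_all add: dlt_def act_simps assms V.scale_right_diff_distrib)

lemma dlt_pow_mem:
  assumes "submod U" "g \<in> SL2Z" "x \<in> U"
  shows "(dlt g ^^ k) x \<in> U"
  by (induction k) (use assms in \<open>auto simp: dlt_def submod_act intro!: V.subspace_diff submod_subspace\<close>)

lemma annihilator_comp:
  assumes "f \<in> annihilator U" "submod U" "g \<in> SL2Z"
  shows "(\<lambda>x. f (act g x)) \<in> annihilator U" "(\<lambda>x. f ((dlt g ^^ k) x)) \<in> annihilator U"
  by (rule annihilatorI; simp add: annihilatorD[OF assms(1)] act_simps dlt_pow_linear dlt_pow_mem submod_act assms)+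

section \<open>Vectors whose orbit is a binary form in the first column\<close>

definition vform :: "nat \<Rightarrow> (nat \<Rightarrow> 'v) \<Rightarrow> rat \<Rightarrow> rat \<Rightarrow> 'v" where
  "vform k c x y = (\<Sum>i\<le>k. smul (x ^ i * y ^ (k - i)) (c i))"

definition coeffs :: "nat \<Rightarrow> 'v set \<Rightarrow> 'v \<Rightarrow> (nat \<Rightarrow> 'v) \<Rightarrow> bool" where
  "coeffs k U v c \<longleftrightarrow> (\<forall>g\<in>SL2Z. act g v - vform k c (of_int (g$1$1)) (of_int (g$2$1)) \<in> U)"

text \<open>The vectors that behave modulo \<open>U\<close> like multiples of \<open>X^k\<close> in
  copies of the symmetric power: \<open>g\<close> with first column \<open>(a, e)\<close> sends
  \<open>X^k\<close> to \<open>(a X + e Y)^k\<close>, a form of degree \<open>k\<close> in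
  \<open>a\<close> and \<open>e\<close>.\<close>

definition hvec :: "nat \<Rightarrow> 'v set \<Rightarrow> 'v set" where
  "hvec k U = {v. \<exists>c. coeffs k U v c}"

definition next_sub :: "nat \<Rightarrow> 'v set \<Rightarrow> 'v set" where
  "next_sub k U = V.span (U \<union> {act g v | g v. g \<in> SL2Z \<and> v \<in> hvec k U})"

lemma annihilator_vform: "f \<in> annihilator U \<Longrightarrow> f (vform k c x y) = form k (\<lambda>i. f (c i)) x y"
  by (simp add: vform_def form_def annihilatorD mult.commute)

text \<open>After applying a functional that vanishes on \<open>W\<close>, the form is a rational
  polynomial with infinitely many zeros, so its coefficients vanish.\<close>

lemma vform_extract:
  assumes W: "V.subspace W" and "\<And>n::nat. vform k c (of_nat n) 1 \<in> W" and "i \<le> k"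
  shows "c i \<in> W"
proof (rule subspace_separation[OF W])
  fix f assume f: "f \<in> annihilator W"
  have "(\<Sum>i\<le>k. f (c i) * of_nat n ^ i) = 0" for n :: nat
    using annihilatorD(7)[OF f assms(2)[of n]] by (simp add: annihilator_vform[OF f] form_def)
  then show "f (c i) = 0" using \<open>i \<le> k\<close> by (rule poly_nat_zero)
qed

lemma coeffs_col:
  assumes "coeffs k U v c" "a * d - b * e = 1"
  shows "act (mat2 a b e d) v - vform k c (of_int a) (of_int e) \<in> U"
  using bspec[OF assms(1)[unfolded coeffs_def], of "mat2 a b e d"] assms(2) by simp

lemma coeffs_annihilator:
  assumes "coeffs k U v c" "a * d - b * e = 1" "f \<in> annihilator U"
  shows "f (act (mat2 a b e d) v) = form k (\<lambda>i. f (c i)) (of_int a) (of_int e)"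
  using annihilator_diff[OF assms(3) coeffs_col[OF assms(1,2)]] by (simp add: annihilator_vform[OF assms(3)])

lemma form_y0: "form k K x 0 = K k * x ^ k"
proof -
  have "form k K x 0 = (\<Sum>i\<le>k. if i = k then K k * x ^ k else 0)"
    unfolding form_def by (intro sum.cong) (auto simp: power_0_left)
  then show ?thesis by simp
qed

lemma coeffs_top:
  assumes "coeffs k U v c" "f \<in> annihilator U"
  shows "f (c k) = f v"
  using coeffs_annihilator[OF assms(1) _ assms(2), of 1 1 0 0] by (simp add: act_one form_y0)

lemma coeffs_add: "V.subspace U \<Longrightarrow> coeffs k U v c \<Longrightarrow> coeffs k U v' c' \<Longrightarrow> coeffs k U (v + v') (\<lambda>i. c i + c' i)"
  unfolding coeffs_def
proof
  fix g assume U: "V.subspace U" and g: "g \<in> SL2Z"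
    and 1: "\<forall>g\<in>SL2Z. act g v - vform k c (of_int (g$1$1)) (of_int (g$2$1)) \<in> U"
    and 2: "\<forall>g\<in>SL2Z. act g v' - vform k c' (of_int (g$1$1)) (of_int (g$2$1)) \<in> U"
  have "vform k (\<lambda>i. c i + c' i) x y = vform k c x y + vform k c' x y" for x y
    by (simp add: vform_def V.scale_right_distrib sum.distrib)
  then show "act g (v + v') - vform k (\<lambda>i. c i + c' i) (of_int (g$1$1)) (of_int (g$2$1)) \<in> U"
    using V.subspace_add[OF U bspec[OF 1 g] bspec[OF 2 g]] by (simp add: act_add g algebra_simps)
qed

lemma coeffs_scale: "V.subspace U \<Longrightarrow> coeffs k U v c \<Longrightarrow> coeffs k U (smul r v) (\<lambda>i. smul r (c i))"
  unfolding coeffs_def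
proof
  fix g assume U: "V.subspace U" and g: "g \<in> SL2Z"
    and 1: "\<forall>g\<in>SL2Z. act g v - vform k c (of_int (g$1$1)) (of_int (g$2$1)) \<in> U"
  have "vform k (\<lambda>i. smul r (c i)) x y = smul r (vform k c x y)" for x y
    by (simp add: vform_def V.scale_sum_right mult.commute)
  then show "act g (smul r v) - vform k (\<lambda>i. smul r (c i)) (of_int (g$1$1)) (of_int (g$2$1)) \<in> U"
    using V.subspace_scale[OF U bspec[OF 1 g], of r] by (simp add: act_smul g V.scale_right_diff_distrib)
qed

lemma coeffs_zero: "submod U \<Longrightarrow> v \<in> U \<Longrightarrow> coeffs k U v (\<lambda>i. 0)"
  by (simp add: coeffs_def vform_def submod_act)

lemma coeffs_mono: "U \<subseteq> U' \<Longrightarrow> coeffs k U v c \<Longrightarrow> coeffs k U' v c"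
  by (auto simp: coeffs_def)

lemma subspace_hvec: "submod U \<Longrightarrow> V.subspace (hvec k U)"
  unfolding V.subspace_def hvec_def
  using coeffs_zero coeffs_add coeffs_scale submod_subspace V.subspace_0 by blast

lemma subset_hvec: "submod U \<Longrightarrow> U \<subseteq> hvec k U"
  using coeffs_zero by (auto simp: hvec_def)

lemma hvec_mono: "U \<subseteq> U' \<Longrightarrow> hvec k U \<subseteq> hvec k U'"
  unfolding hvec_def using coeffs_mono by blast

lemma subspace_next_sub: "V.subspace (next_sub k U)"
  by (simp add: next_sub_def V.subspace_span)

lemma subset_next_sub: "U \<subseteq> next_sub k U"
  by (auto simp: next_sub_def V.span_base)

lemma act_hvec_next_sub: "g \<in> SL2Z \<Longrightarrow> v \<in> hvec k U \<Longrightarrow> act g v \<in> next_sub k U"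
  by (auto simp: next_sub_def intro: V.span_base)

lemma hvec_subset_next_sub: "hvec k U \<subseteq> next_sub k U"
  using act_hvec_next_sub[of "mat2 1 0 0 1"] by (auto simp: act_one)

lemma next_sub_mono: "U \<subseteq> U' \<Longrightarrow> next_sub k U \<subseteq> next_sub k U'"
  unfolding next_sub_def using hvec_mono[of U U' k] by (intro V.span_mono) blast

lemma next_sub_induct [consumes 2, case_names base gen add scale]:
  assumes "x \<in> next_sub k U" "submod U"
    and "\<And>x. x \<in> U \<Longrightarrow> P x" "\<And>g v. g \<in> SL2Z \<Longrightarrow> v \<in> hvec k U \<Longrightarrow> P (act g v)"
    and "\<And>x y. P x \<Longrightarrow> P y \<Longrightarrow> P (x + y)" "\<And>r x. P x \<Longrightarrow> P (smul r x)"
  shows "P x"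
  using assms(1) unfolding next_sub_def
proof (rule V.span_induct)
  show "P x" if "x \<in> U \<union> {act g v |g v. g \<in> SL2Z \<and> v \<in> hvec k U}" for x
    using that assms(3,4) by auto
  have "0 \<in> U" using assms(2) submod_subspace V.subspace_0 by blast
  then show "V.subspace (Collect P)"
    using assms(3,5,6) by (auto simp: V.subspace_def)
qed

lemma submod_next_sub:
  assumes "submod U"
  shows "submod (next_sub k U)"
  unfolding submodule_def
proof (intro conjI ballI subspace_next_sub)
  fix g x assume g: "g \<in> SL2Z" and x: "x \<in> next_sub k U"
  from x assms show "act g x \<in> next_sub k U"
  proof (induction rule: next_sub_induct)
    case (base x)
    then show ?case using submod_act[OF assms g] subset_next_sub by blast
  next
    case (gen h v)
    then show ?case using g by (simp add: act_act act_hvec_next_sub)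
  qed (use g assms in \<open>auto simp: act_simps intro: V.subspace_add V.subspace_scale subspace_next_sub\<close>)
qed

text \<open>On \<open>Sym\<^sup>k\<close> the operator \<open>(u - 1)\<^sup>k\<close> maps \<open>P\<close> to \<open>k! P(0,1) X\<^sup>k\<close>; after the lower unipotent
  \<open>X \<mapsto> X + n Y\<close> it therefore reads off the value \<open>P(n, 1)\<close>.\<close>

definition probe :: "nat \<Rightarrow> int \<Rightarrow> 'v \<Rightarrow> 'v" where
  "probe k n x = (dlt (mat2 1 1 0 1) ^^ k) (act (mat2 1 0 n 1) x)"

lemma probe_linear: "probe k n (x + y) = probe k n x + probe k n y"
    "probe k n (smul r x) = smul r (probe k n x)"
  by (simp_all add: probe_def act_simps dlt_pow_linear)

lemma probe_mem: "submod U \<Longrightarrow> x \<in> U \<Longrightarrow> probe k n x \<in> U"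
  by (simp add: probe_def dlt_pow_mem submod_act)

lemma annihilator_probe:
  assumes "f \<in> annihilator U" "submod U"
  shows "(\<lambda>x. f (probe k n x)) \<in> annihilator U"
  by (rule annihilatorI) (simp_all add: probe_linear probe_mem annihilatorD[OF assms(1)] assms)

text \<open>With \<open>v\<close> in the role of \<open>X^k\<close>, the coefficient
  \<open>c i\<close> plays \<open>(k choose i) X^i Y^(k - i)\<close>, on which \<open>probe\<close>
  reads off \<open>(k choose i) n^i\<close>. The proof applies \<open>probe\<close> to the images of
  \<open>v\<close> with first column \<open>(m, 1)\<close> and compares the two resulting
  polynomials in \<open>m\<close>.\<close>

lemma probe_coeffs:
  assumes c: "coeffs k U v c" and U: "submod U" and i: "i \<le> k" and f: "f \<in> annihilator U"
  shows "f (probe k n (c i)) = fact k * of_nat (k choose i) * of_int n ^ i * f v"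
proof -
  have "(\<Sum>i\<le>k. (f (probe k n (c i)) - fact k * of_nat (k choose i) * of_int n ^ i * f v) * of_nat m ^ i) = 0" for m :: nat
  proof -
    \<comment> \<open>The lower unipotent moves the column \<open>(m, 1)\<close> to
      \<open>(m, a)\<close>; powers of the upper one then add multiples of \<open>a\<close> to the
      top entry, so the \<open>k\<close>-th difference of the form is \<open>k!\<close> times its
      value at \<open>(a, 0)\<close>.\<close>
    define a where "a = n * int m + 1"
    have "f (probe k n (act (mat2 (int m) (- 1) 1 0) v))
        = f ((dlt (mat2 1 1 0 1) ^^ k) (act (mat2 (int m + 0 * a) (- 1 + 0 * (- n)) a (- n)) v))"
      by (simp add: probe_def act_act a_def)
    also have "\<dots> = f ((fdiff ^^ k) (\<lambda>j. act (mat2 (int m + j * a) (- 1 + j * (- n)) a (- n)) v) 0)"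
      (is "_ = f ((fdiff ^^ k) ?s 0)")
    proof -
      have "act (mat2 (int m + (j + 1) * a) (- 1 + (j + 1) * (- n)) a (- n)) v =
          act (mat2 1 1 0 1) (act (mat2 (int m + j * a) (- 1 + j * (- n)) a (- n)) v)" for j
        by (subst act_act) (simp_all add: a_def algebra_simps)
      then have "(dlt (mat2 1 1 0 1) ^^ k) (?s 0) = (fdiff ^^ k) ?s 0"
        by (intro dlt_pow_fdiff) simp_all
      then show ?thesis by simp
    qed
    also have "\<dots> = (fdiff ^^ k) (\<lambda>j. f (act (mat2 (int m + j * a) (- 1 + j * (- n)) a (- n)) v)) 0"
      by (rule fdiff_pow_additive) (simp add: annihilatorD[OF f])
    also have "\<dots> = (fdiff ^^ k) (\<lambda>j. form k (\<lambda>i. f (c i)) (of_int (int m) + of_int j * of_int a) (of_int a + of_int j * 0)) 0"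
    proof -
      have "f (act (mat2 (int m + j * a) (- 1 + j * (- n)) a (- n)) v) =
          form k (\<lambda>i. f (c i)) (of_int (int m) + of_int j * of_int a) (of_int a + of_int j * 0)" for j
        by (subst coeffs_annihilator[OF c _ f]) (simp_all add: a_def algebra_simps)
      then show ?thesis by simp
    qed
    also have "\<dots> = fact k * (f v * of_int a ^ k)"
      by (simp only: fdiff_form form_y0 coeffs_top[OF c f])
    also have "of_int a ^ k = (\<Sum>i\<le>k. of_nat (k choose i) * (of_int n * of_nat m :: rat) ^ i)"
      unfolding a_def using binomial_ring[of "of_int n * of_nat m :: rat" 1 k] by simp
    finally have "f (probe k n (act (mat2 (int m) (- 1) 1 0) v)) =
        (\<Sum>i\<le>k. fact k * of_nat (k choose i) * of_int n ^ i * f v * of_nat m ^ i)"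
      by (simp add: sum_distrib_left power_mult_distrib mult_ac)
    moreover have "f (probe k n (act (mat2 (int m) (- 1) 1 0) v)) = (\<Sum>i\<le>k. f (probe k n (c i)) * of_nat m ^ i)"
      using coeffs_annihilator[OF c _ annihilator_probe[OF f U], of "int m" 0 "- 1" 1 k n] by (simp add: form_def)
    ultimately show ?thesis by (simp add: algebra_simps sum_subtractf)
  qed
  from poly_nat_zero[OF this i] show ?thesis by simp
qed

text \<open>In the model \<open>x\<close> is the sum of \<open>(k choose i) X^i Y^(k - i)\<close>
  tensored with \<open>w i\<close>, where \<open>c i i\<close> is that monomial in the copies
  generated by \<open>w i\<close>. It is a relation because \<open>w\<close> is determined only
  modulo \<open>U\<close>.\<close>

definition coordinates :: "nat \<Rightarrow> 'v set \<Rightarrow> 'v \<Rightarrow> (nat \<Rightarrow> 'v) \<Rightarrow> bool" where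
  "coordinates k U x w \<longleftrightarrow> (\<exists>c. (\<forall>i\<le>k. coeffs k U (w i) (c i)) \<and> x - (\<Sum>i\<le>k. c i i) \<in> U)"

lemma coordinates_hvec: "coordinates k U x w \<Longrightarrow> i \<le> k \<Longrightarrow> w i \<in> hvec k U"
  by (auto simp: coordinates_def hvec_def)

lemma coordinates_add:
  assumes "submod U" "coordinates k U x w" "coordinates k U y z"
  shows "coordinates k U (x + y) (\<lambda>i. w i + z i)"
proof -
  obtain c d where c: "\<forall>i\<le>k. coeffs k U (w i) (c i)" "x - (\<Sum>i\<le>k. c i i) \<in> U"
    and d: "\<forall>i\<le>k. coeffs k U (z i) (d i)" "y - (\<Sum>i\<le>k. d i i) \<in> U"
    using assms by (auto simp: coordinates_def)
  have "x + y - (\<Sum>i\<le>k. c i i + d i i) \<in> U"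
    using V.subspace_add[OF submod_subspace[OF assms(1)] c(2) d(2)] by (simp add: sum.distrib algebra_simps)
  moreover have "\<forall>i\<le>k. coeffs k U (w i + z i) (\<lambda>j. c i j + d i j)"
    using c d coeffs_add submod_subspace[OF assms(1)] by blast
  ultimately show ?thesis unfolding coordinates_def by (intro exI[of _ "\<lambda>i j. c i j + d i j"]) simp
qed

lemma coordinates_scale:
  assumes "submod U" "coordinates k U x w"
  shows "coordinates k U (smul r x) (\<lambda>i. smul r (w i))"
proof -
  obtain c where c: "\<forall>i\<le>k. coeffs k U (w i) (c i)" "x - (\<Sum>i\<le>k. c i i) \<in> U"
    using assms by (auto simp: coordinates_def)
  have "smul r x - (\<Sum>i\<le>k. smul r (c i i)) \<in> U"
    using V.subspace_scale[OF submod_subspace[OF assms(1)] c(2), of r]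
    by (simp add: V.scale_right_diff_distrib V.scale_sum_right)
  moreover have "\<forall>i\<le>k. coeffs k U (smul r (w i)) (\<lambda>j. smul r (c i j))"
    using c coeffs_scale submod_subspace[OF assms(1)] by blast
  ultimately show ?thesis unfolding coordinates_def by (intro exI[of _ "\<lambda>i j. smul r (c i j)"]) simp
qed

lemma coordinates_zero: "submod U \<Longrightarrow> x \<in> U \<Longrightarrow> coordinates k U x (\<lambda>i. 0)"
  unfolding coordinates_def
  by (intro exI[of _ "\<lambda>i j. 0"]) (simp add: coeffs_zero V.subspace_0 submod_subspace)

lemma coordinates_gen:
  assumes "submod U" "v \<in> hvec k U" "h \<in> SL2Z"
  shows "coordinates k U (act h v) (\<lambda>i. smul (of_int (h$1$1) ^ i * of_int (h$2$1) ^ (k - i)) v)"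
proof -
  obtain c where c: "coeffs k U v c" using assms(2) by (auto simp: hvec_def)
  then have "act h v - (\<Sum>i\<le>k. smul (of_int (h$1$1) ^ i * of_int (h$2$1) ^ (k - i)) (c i)) \<in> U"
    using assms(3) by (simp add: coeffs_def vform_def)
  moreover have "\<forall>i\<le>k. coeffs k U (smul (of_int (h$1$1) ^ i * of_int (h$2$1) ^ (k - i)) v)
      (\<lambda>j. smul (of_int (h$1$1) ^ i * of_int (h$2$1) ^ (k - i)) (c j))"
    using coeffs_scale[OF submod_subspace[OF assms(1)] c] by blast
  ultimately show ?thesis
    unfolding coordinates_def
    by (intro exI[of _ "\<lambda>i j. smul (of_int (h$1$1) ^ i * of_int (h$2$1) ^ (k - i)) (c j)"]) simp
qed

text \<open>Probing a representation of \<open>x\<close> for every \<open>n\<close> yields a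
  polynomial in \<open>n\<close> whose coefficients are nonzero multiples of the values
  \<open>f (w i)\<close>. This is the uniqueness of coordinates modulo \<open>U\<close>.\<close>

lemma coordinates_mem_zero:
  assumes U: "submod U" and R: "coordinates k U x w" and x: "x \<in> U" and i: "i \<le> k"
  shows "w i \<in> U"
proof (rule subspace_separation[OF submod_subspace[OF U]])
  fix f assume f: "f \<in> annihilator U"
  obtain c where c: "\<forall>i\<le>k. coeffs k U (w i) (c i)" "x - (\<Sum>i\<le>k. c i i) \<in> U"
    using R by (auto simp: coordinates_def)
  have "(\<Sum>i\<le>k. (fact k * of_nat (k choose i) * f (w i)) * of_nat n ^ i) = 0" for n :: nat
  proof -
    note fp = annihilator_probe[OF f U, of k "int n"]
    have "0 = f (probe k (int n) (\<Sum>i\<le>k. c i i))"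
      using annihilator_diff[OF fp c(2)] annihilatorD(7)[OF fp x] by simp
    also have "\<dots> = (\<Sum>i\<le>k. f (probe k (int n) (c i i)))"
      by (rule annihilatorD(6)[OF fp])
    also have "\<dots> = (\<Sum>i\<le>k. fact k * of_nat (k choose i) * of_int (int n) ^ i * f (w i))"
      using probe_coeffs[OF _ U _ f] c(1) by (intro sum.cong) auto
    finally show ?thesis by (simp add: mult_ac)
  qed
  from poly_nat_zero[OF this i] show "f (w i) = 0" using i by simp
qed

text \<open>The images of \<open>v\<close> under matrices with first column \<open>(n, 1)\<close>
  lie in the extension, and their coefficients as a polynomial in \<open>n\<close> can be
  extracted.\<close>

lemma coeffs_next_sub:
  assumes "submod U" "coeffs k U v c" "i \<le> k" "v \<in> hvec k U"
  shows "c i \<in> next_sub k U"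
proof (rule vform_extract[OF subspace_next_sub _ assms(3)])
  fix n :: nat
  let ?g = "mat2 (int n) (- 1) 1 0"
  have "act ?g v - vform k c (of_nat n) 1 \<in> next_sub k U"
    using coeffs_col[OF assms(2), of "int n" 0 "- 1" 1] subset_next_sub by auto
  moreover have "act ?g v \<in> next_sub k U" by (rule act_hvec_next_sub[OF _ assms(4)]) simp
  ultimately show "vform k c (of_nat n) 1 \<in> next_sub k U"
    using V.subspace_diff[OF subspace_next_sub, of "act ?g v" k U "act ?g v - vform k c (of_nat n) 1"] by simp
qed

lemma coeffs_mem:
  assumes "submod U" "coeffs k U v c" "i \<le> k" "v \<in> U"
  shows "c i \<in> U"
proof (rule vform_extract[OF submod_subspace[OF assms(1)] _ assms(3)])
  fix n :: nat
  let ?g = "mat2 (int n) (- 1) 1 0"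
  have "act ?g v - vform k c (of_nat n) 1 \<in> U"
    using coeffs_col[OF assms(2), of "int n" 0 "- 1" 1] by auto
  moreover have "act ?g v \<in> U" by (rule submod_act[OF assms(1) _ assms(4)]) simp
  ultimately show "vform k c (of_nat n) 1 \<in> U"
    using V.subspace_diff[OF submod_subspace[OF assms(1)], of "act ?g v" "act ?g v - vform k c (of_nat n) 1"] by simp
qed

lemma coordinates_exists:
  assumes "submod U" "\<And>i. i \<le> k \<Longrightarrow> w i \<in> hvec k U"
  shows "\<exists>x\<in>next_sub k U. coordinates k U x w"
proof -
  obtain c where c: "\<And>i. i \<le> k \<Longrightarrow> coeffs k U (w i) (c i)"
    using assms(2) unfolding hvec_def mem_Collect_eq by metis
  have "(\<Sum>i\<le>k. c i i) \<in> next_sub k U"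
    using c assms by (intro V.subspace_sum subspace_next_sub coeffs_next_sub) auto
  moreover have "coordinates k U (\<Sum>i\<le>k. c i i) w"
    unfolding coordinates_def using c V.subspace_0[OF submod_subspace[OF assms(1)]] by (intro exI[of _ c]) auto
  ultimately show ?thesis by blast
qed

lemma coordinates_all_mem:
  assumes "submod U" "coordinates k U x w" "\<And>i. i \<le> k \<Longrightarrow> w i \<in> U"
  shows "x \<in> U"
proof -
  obtain c where c: "\<forall>i\<le>k. coeffs k U (w i) (c i)" "x - (\<Sum>i\<le>k. c i i) \<in> U"
    using assms(2) by (auto simp: coordinates_def)
  have "c i i \<in> U" if "i \<le> k" for i
    using coeffs_mem[OF assms(1)] c(1) assms(3) that by blast
  then have "(\<Sum>i\<le>k. c i i) \<in> U"
    by (intro V.subspace_sum[OF submod_subspace[OF assms(1)]]) simp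
  from V.subspace_add[OF submod_subspace[OF assms(1)] c(2) this] show ?thesis by simp
qed

section \<open>The extension as a sum of copies of a symmetric power\<close>

lemma relative_coordinates:
  assumes U: "V.subspace U" and H: "V.subspace H" and UH: "U \<subseteq> H"
  obtains B lam where "B \<subseteq> H" "\<And>b. b \<in> B \<Longrightarrow> lam b \<in> annihilator U"
    "\<And>b b'. b \<in> B \<Longrightarrow> b' \<in> B \<Longrightarrow> lam b b' = (if b = b' then 1 else 0)"
    "\<And>x. finite {b \<in> B. lam b x \<noteq> 0}"
    "\<And>x. x \<in> H \<Longrightarrow> \<forall>b\<in>B. lam b x = 0 \<Longrightarrow> x \<in> U"
proof -
  obtain A where A: "A \<subseteq> U" "V.independent A" "U \<subseteq> V.span A"
    using V.maximal_independent_subset by blast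
  obtain C where C: "A \<subseteq> C" "C \<subseteq> H" "V.independent C" "H \<subseteq> V.span C"
    using V.maximal_independent_subset_extend[of A H] A UH by blast
  have sA: "V.span A = U" using A U by (simp add: V.span_subspace)
  have sC: "V.span C = H" using C H by (simp add: V.span_subspace)
  \<comment> \<open>\<open>C - A\<close> represents a basis of \<open>H\<close> modulo
    \<open>U\<close>. Extending \<open>C\<close> to a basis of the whole space makes the dual
    functionals defined everywhere, as \<open>annihilator\<close> requires.\<close>
  define E where "E = V.extend_basis C"
  have E: "V.independent E" "V.span E = UNIV" "C \<subseteq> E"
    using C V.independent_extend_basis V.span_extend_basis V.extend_basis_superset by (auto simp: E_def)
  define lam where "lam b x = V.representation E x b" for b x
  have rep_on: "V.representation E x = V.representation S x" if "S \<subseteq> E" "x \<in> V.span S" for S x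
    using V.representation_extend[OF E(1) that(2,1)] .
  show ?thesis
  proof (rule that[of "C - A" lam])
    show "C - A \<subseteq> H" using C by auto
    show "lam b \<in> annihilator U" if b: "b \<in> C - A" for b
    proof (rule annihilatorI)
      show "lam b (x + y) = lam b x + lam b y" "lam b (smul r x) = r * lam b x" for x y r
        using E by (simp_all add: lam_def V.representation_add V.representation_scale)
      show "lam b x = 0" if "x \<in> U" for x
      proof -
        have "V.representation E x = V.representation A x"
          using that sA C(1) E(3) by (intro rep_on) auto
        then show ?thesis using b V.representation_ne_zero unfolding lam_def by (metis DiffD2)
      qed
    qed
    show "lam b b' = (if b = b' then 1 else 0)" if "b \<in> C - A" "b' \<in> C - A" for b b'
      using that E by (auto simp: lam_def V.representation_basis)
    show "finite {b \<in> C - A. lam b x \<noteq> 0}" for x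
      using V.finite_representation[of E x] by (rule rev_finite_subset) (auto simp: lam_def)
    show "x \<in> U" if x: "x \<in> H" and 0: "\<forall>b\<in>C - A. lam b x = 0" for x
    proof -
      have r: "V.representation E x = V.representation C x"
        using x sC E(3) by (intro rep_on) auto
      have "x = (\<Sum>b\<in>{b. V.representation C x b \<noteq> 0}. smul (V.representation C x b) b)"
        using V.sum_nonzero_representation_eq[OF C(3), of x] x sC by simp
      also have "\<dots> \<in> U"
      proof (intro V.subspace_sum V.subspace_scale U)
        fix b assume "b \<in> {b. V.representation C x b \<noteq> 0}"
        then show "b \<in> U" using bspec[OF 0, of b] r V.representation_ne_zero[of C x b] A(1)
          by (auto simp: lam_def)
      qed
      finally show ?thesis .
    qed
  qed
qed

lemma sym_act_pow_form:
  "sym_act h (\<lambda>(X, Y). l * (of_int a * X + of_int c * Y) ^ k) =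
    (\<lambda>(X, Y). l * (of_int (h$1$1 * a + h$1$2 * c) * X + of_int (h$2$1 * a + h$2$2 * c) * Y) ^ k)"
  by (simp add: sym_act_def fun_eq_iff algebra_simps)

text \<open>The copies are indexed by a basis \<open>B\<close> of \<open>hvec k U\<close> modulo
  \<open>U\<close>; the component of \<open>x\<close> at \<open>b\<close> is the form whose
  coefficients are the \<open>b\<close>-coordinates of \<open>w i\<close>, weighted by binomial
  coefficients.\<close>

lemma factor_next_sub:
  assumes U: "submod U"
  shows "factor_is_sum_Sym smul act k U (next_sub k U)"
proof -
  obtain B lam where BH: "B \<subseteq> hvec k U" and lam: "\<And>b. b \<in> B \<Longrightarrow> lam b \<in> annihilator U"
    and delta: "\<And>b b'. b \<in> B \<Longrightarrow> b' \<in> B \<Longrightarrow> lam b b' = (if b = b' then 1 else (0::rat))"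
    and fin: "\<And>x. finite {b \<in> B. lam b x \<noteq> 0}"
    and sep: "\<And>x. x \<in> hvec k U \<Longrightarrow> \<forall>b\<in>B. lam b x = 0 \<Longrightarrow> x \<in> U"
    by (rule relative_coordinates[OF submod_subspace[OF U] subspace_hvec[OF U] subset_hvec[OF U]]) (rule that; assumption)
  \<comment> \<open>The binomial weights make the generator with first column \<open>(a, c)\<close>
    correspond to \<open>(a X + c Y)^k\<close>, on which equivariance is visible.\<close>
  define P where "P w b = (\<lambda>(X::rat, Y). \<Sum>i\<le>k. (of_nat (k choose i) * lam b (w i)) * X ^ i * Y ^ (k - i))" for w b
  define W where "W x = (SOME w. coordinates k U x w)" for x
  define \<phi> where "\<phi> x b = (if b \<in> B then P (W x) b else (\<lambda>_. 0))" for x b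
  have P_add: "P (\<lambda>i. w i + z i) b = (\<lambda>p. P w b p + P z b p)" if "b \<in> B" for w z b
    by (simp add: P_def fun_eq_iff annihilatorD[OF lam[OF that]] algebra_simps sum.distrib)
  have P_scale: "P (\<lambda>i. smul r (w i)) b = (\<lambda>p. r * P w b p)" if "b \<in> B" for w r b
    by (simp add: P_def fun_eq_iff annihilatorD[OF lam[OF that]] sum_distrib_left mult_ac)
  have P_zero: "P (\<lambda>i. 0) b = (\<lambda>p. 0)" if "b \<in> B" for b
    by (simp add: P_def fun_eq_iff annihilatorD[OF lam[OF that]])
  have P_gen: "P (\<lambda>i. smul (of_int a ^ i * of_int c ^ (k - i)) v) b =
      (\<lambda>(X, Y). lam b v * (of_int a * X + of_int c * Y) ^ k)" if "b \<in> B" for a c v b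
    unfolding P_def binomial_ring sum_distrib_left fun_eq_iff split_beta annihilatorD(2)[OF lam[OF that]]
    by (intro allI sum.cong refl) (simp add: power_mult_distrib)
  \<comment> \<open>Existence of coordinates and equivariance are proved together by induction,
    since the action on coordinates is explicit only on generators. Some compatible choice suffices,
    as \<open>P\<close> will turn out to be independent of the choice.\<close>
  have ex: "\<exists>w. coordinates k U x w \<and> (\<forall>g\<in>SL2Z. \<exists>w'. coordinates k U (act g x) w' \<and> (\<forall>b\<in>B. P w' b = sym_act g (P w b)))"
    if "x \<in> next_sub k U" for x
    using that U
  proof (induction rule: next_sub_induct)
    case (base x)
    show ?case
    proof (intro exI[of _ "\<lambda>i. 0"] conjI ballI)
      show "coordinates k U x (\<lambda>i. 0)" by (rule coordinates_zero[OF U base])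
      show "coordinates k U (act g x) (\<lambda>i. 0)" if "g \<in> SL2Z" for g
        by (rule coordinates_zero[OF U submod_act[OF U that base]])
      show "P (\<lambda>i. 0) b = sym_act g (P (\<lambda>i. 0) b)" if "b \<in> B" for g b
        by (simp add: P_zero[OF that] sym_act_def fun_eq_iff)
    qed
  next
    case (gen h v)
    let ?w = "\<lambda>h :: int^2^2. \<lambda>i. smul (of_int (h$1$1) ^ i * of_int (h$2$1) ^ (k - i)) v"
    show ?case
    proof (rule exI[of _ "?w h"], intro conjI ballI)
      show "coordinates k U (act h v) (?w h)" by (rule coordinates_gen[OF U gen(2,1)])
      fix g assume g: "g \<in> SL2Z"
      show "\<exists>w'. coordinates k U (act g (act h v)) w' \<and> (\<forall>b\<in>B. P w' b = sym_act g (P (?w h) b))"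
      proof (intro exI[of _ "?w (g ** h)"] conjI ballI)
        show "coordinates k U (act g (act h v)) (?w (g ** h))"
          using coordinates_gen[OF U gen(2) SL2Z_mult[OF g gen(1)]] by (simp only: act_act[OF g gen(1)])
        show "P (?w (g ** h)) b = sym_act g (P (?w h) b)" if "b \<in> B" for b
          unfolding P_gen[OF that] sym_act_pow_form mult_nth2 ..
      qed
    qed
  next
    case (add x y)
    then obtain w z where w: "coordinates k U x w" "\<forall>g\<in>SL2Z. \<exists>w'. coordinates k U (act g x) w' \<and> (\<forall>b\<in>B. P w' b = sym_act g (P w b))"
      and z: "coordinates k U y z" "\<forall>g\<in>SL2Z. \<exists>w'. coordinates k U (act g y) w' \<and> (\<forall>b\<in>B. P w' b = sym_act g (P z b))"
      by blast
    show ?case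
    proof (rule exI[of _ "\<lambda>i. w i + z i"], intro conjI ballI)
      show "coordinates k U (x + y) (\<lambda>i. w i + z i)" by (rule coordinates_add[OF U w(1) z(1)])
      fix g assume g: "g \<in> SL2Z"
      obtain w' z' where w': "coordinates k U (act g x) w'" "\<forall>b\<in>B. P w' b = sym_act g (P w b)"
        and z': "coordinates k U (act g y) z'" "\<forall>b\<in>B. P z' b = sym_act g (P z b)" using w(2) z(2) g by blast
      show "\<exists>w'. coordinates k U (act g (x + y)) w' \<and> (\<forall>b\<in>B. P w' b = sym_act g (P (\<lambda>i. w i + z i) b))"
        using coordinates_add[OF U w'(1) z'(1)] w'(2) z'(2)
        by (intro exI[of _ "\<lambda>i. w' i + z' i"]) (simp add: act_add g P_add sym_act_def fun_eq_iff)
    qed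
  next
    case (scale r x)
    then obtain w where w: "coordinates k U x w" "\<forall>g\<in>SL2Z. \<exists>w'. coordinates k U (act g x) w' \<and> (\<forall>b\<in>B. P w' b = sym_act g (P w b))"
      by blast
    show ?case
    proof (rule exI[of _ "\<lambda>i. smul r (w i)"], intro conjI ballI)
      show "coordinates k U (smul r x) (\<lambda>i. smul r (w i))" by (rule coordinates_scale[OF U w(1)])
      fix g assume g: "g \<in> SL2Z"
      obtain w' where w': "coordinates k U (act g x) w'" "\<forall>b\<in>B. P w' b = sym_act g (P w b)" using w(2) g by blast
      show "\<exists>w'. coordinates k U (act g (smul r x)) w' \<and> (\<forall>b\<in>B. P w' b = sym_act g (P (\<lambda>i. smul r (w i)) b))"
        using coordinates_scale[OF U w'(1)] w'(2)
        by (intro exI[of _ "\<lambda>i. smul r (w' i)"]) (simp add: act_smul g P_scale sym_act_def fun_eq_iff)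
    qed
  qed
  have P_unique: "P w b = P z b" if "coordinates k U x w" "coordinates k U x z" "b \<in> B" for x w z b
  proof -
    have "coordinates k U (x + smul (- 1) x) (\<lambda>i. w i + smul (- 1) (z i))"
      by (intro coordinates_add coordinates_scale U that)
    then have "w i + smul (- 1) (z i) \<in> U" if "i \<le> k" for i
      by (rule coordinates_mem_zero[OF U _ _ that]) (simp add: V.subspace_0[OF submod_subspace[OF U]])
    then have "lam b (w i) = lam b (z i)" if "i \<le> k" for i
      using annihilator_diff[OF lam[OF \<open>b \<in> B\<close>], of "w i" "z i"] that by simp
    then show ?thesis unfolding P_def fun_eq_iff by (auto intro!: sum.cong)
  qed
  have RW: "coordinates k U x (W x)" if "x \<in> next_sub k U" for x
    unfolding W_def using ex[OF that] by (metis someI_ex)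
  have \<phi>_eq: "\<phi> x b = P w b" if "x \<in> next_sub k U" "coordinates k U x w" "b \<in> B" for x w b
    using P_unique[OF RW[OF that(1)] that(2,3)] that(3) by (simp add: \<phi>_def)
  have \<phi>_out: "\<phi> x b = (\<lambda>_. 0)" if "b \<notin> B" for x b
    using that by (simp add: \<phi>_def)
  note sub = subspace_next_sub[of k U]
  show ?thesis
    unfolding factor_is_sum_Sym_def
  proof (intro exI[of _ B] exI[of _ \<phi>] conjI ballI allI)
    fix x y assume x: "x \<in> next_sub k U" and y: "y \<in> next_sub k U"
    have "\<phi> (x + y) b = (\<lambda>p. \<phi> x b p + \<phi> y b p)" for b
      using \<phi>_eq[OF V.subspace_add[OF sub x y] coordinates_add[OF U RW[OF x] RW[OF y]], of b]
        \<phi>_eq[OF x RW[OF x], of b] \<phi>_eq[OF y RW[OF y], of b] \<phi>_out[of b] P_add[of b]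
      by (cases "b \<in> B") simp_all
    then show "\<phi> (x + y) = (\<lambda>i p. \<phi> x i p + \<phi> y i p)" by blast
  next
    fix r x assume x: "x \<in> next_sub k U"
    have "\<phi> (smul r x) b = (\<lambda>p. r * \<phi> x b p)" for b
      using \<phi>_eq[OF V.subspace_scale[OF sub x] coordinates_scale[OF U RW[OF x]], of b r]
        \<phi>_eq[OF x RW[OF x], of b] \<phi>_out[of b] P_scale[of b]
      by (cases "b \<in> B") simp_all
    then show "\<phi> (smul r x) = (\<lambda>i p. r * \<phi> x i p)" by blast
  next
    fix g x assume g: "g \<in> SL2Z" and x: "x \<in> next_sub k U"
    obtain w w' where w: "coordinates k U x w" "coordinates k U (act g x) w'" "\<forall>b\<in>B. P w' b = sym_act g (P w b)"
      using ex[OF x] g by blast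
    have gx: "act g x \<in> next_sub k U" using submod_next_sub[OF U] g x by (simp add: submod_act)
    have "\<phi> (act g x) b = sym_act g (\<phi> x b)" for b
    proof (cases "b \<in> B")
      case True
      then show ?thesis using \<phi>_eq[OF gx w(2)] \<phi>_eq[OF x w(1)] w(3) by simp
    qed (simp add: \<phi>_out sym_act_def fun_eq_iff)
    then show "\<phi> (act g x) = (\<lambda>i. sym_act g (\<phi> x i))" by blast
  next
    show "\<phi> ` next_sub k U = dsum_Sym k B"
    proof (intro equalityI subsetI)
      fix F assume "F \<in> \<phi> ` next_sub k U"
      then obtain x where x: "x \<in> next_sub k U" and F: "F = \<phi> x" by blast
      have "P w b \<in> Sym k" for w b
        unfolding P_def Sym_def mem_Collect_eq by (rule exI, rule refl)
      then have "\<phi> x b \<in> Sym k" if "b \<in> B" for b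
        using that by (simp add: \<phi>_def)
      moreover have "finite {b. \<phi> x b \<noteq> (\<lambda>_. 0)}"
      proof (rule finite_subset)
        show "finite (\<Union>i\<in>{..k}. {b \<in> B. lam b (W x i) \<noteq> 0})" using fin by blast
        show "{b. \<phi> x b \<noteq> (\<lambda>_. 0)} \<subseteq> (\<Union>i\<in>{..k}. {b \<in> B. lam b (W x i) \<noteq> 0})"
        proof
          fix b assume "b \<in> {b. \<phi> x b \<noteq> (\<lambda>_. 0)}"
          then have "b \<in> B" "P (W x) b \<noteq> (\<lambda>_. 0)" by (auto simp: \<phi>_def split: if_splits)
          have "\<exists>i\<le>k. lam b (W x i) \<noteq> 0"
          proof (rule ccontr)
            assume "\<not> (\<exists>i\<le>k. lam b (W x i) \<noteq> 0)"
            then have "P (W x) b = (\<lambda>_. 0)" by (simp add: P_def fun_eq_iff)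
            with \<open>P (W x) b \<noteq> (\<lambda>_. 0)\<close> show False by blast
          qed
          with \<open>b \<in> B\<close> show "b \<in> (\<Union>i\<in>{..k}. {b \<in> B. lam b (W x i) \<noteq> 0})" by blast
        qed
      qed
      ultimately show "F \<in> dsum_Sym k B"
        unfolding F dsum_Sym_def using \<phi>_out by blast
    next
      fix F assume F: "F \<in> dsum_Sym k B"
      define S where "S = {b. F b \<noteq> (\<lambda>_. 0)}"
      have S: "finite S" "S \<subseteq> B" using F by (auto simp: S_def dsum_Sym_def)
      define e where "e b = (SOME e. F b = (\<lambda>(x, y). \<Sum>i\<le>k. e i * x ^ i * y ^ (k - i)))" for b
      have e: "F b = (\<lambda>(x, y). \<Sum>i\<le>k. e b i * x ^ i * y ^ (k - i))" if "b \<in> B" for b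
      proof -
        have "F b \<in> Sym k" using F that by (simp add: dsum_Sym_def)
        then show ?thesis unfolding Sym_def mem_Collect_eq e_def by (rule someI_ex)
      qed
      \<comment> \<open>Dividing by the binomial coefficient undoes the weight in \<open>P\<close>.
        For \<open>i > k\<close> the division by zero gives 0, so \<open>w i\<close> is harmless
        there.\<close>
      define w where "w i = (\<Sum>b\<in>S. smul (e b i / of_nat (k choose i)) b)" for i
      have "w i \<in> hvec k U" for i
        unfolding w_def using S BH by (intro V.subspace_sum V.subspace_scale subspace_hvec U) auto
      then obtain x where x: "x \<in> next_sub k U" "coordinates k U x w" using coordinates_exists[OF U] by blast
      have lw: "lam b (w i) = (if b \<in> S then e b i / of_nat (k choose i) else 0)" if "b \<in> B" for b i
      proof -
        have "lam b (w i) = (\<Sum>b'\<in>S. e b' i / of_nat (k choose i) * lam b b')"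
          unfolding w_def by (simp add: annihilatorD[OF lam[OF that]])
        also have "\<dots> = (\<Sum>b'\<in>S. if b' = b then e b i / of_nat (k choose i) else 0)"
          using S that by (intro sum.cong) (auto simp: delta)
        finally show ?thesis using S by simp
      qed
      have "\<phi> x b = F b" for b
      proof (cases "b \<in> B")
        case True
        then have "\<phi> x b = P w b" by (rule \<phi>_eq[OF x])
        also have "\<dots> = F b"
        proof (cases "b \<in> S")
          case bS: True
          show ?thesis unfolding P_def e[OF True] lw[OF True] fun_eq_iff
            using bS by (auto intro!: sum.cong)
        next
          case False
          then have "F b = (\<lambda>_. 0)" by (simp add: S_def)
          then show ?thesis using False by (simp add: P_def lw[OF True] fun_eq_iff)
        qed
        finally show ?thesis .
      next
        case False
        then show ?thesis using F \<phi>_out by (simp add: dsum_Sym_def)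
      qed
      then have "\<phi> x = F" by (rule ext)
      then show "F \<in> \<phi> ` next_sub k U" using x(1) by blast
    qed
  next
    fix x assume x: "x \<in> next_sub k U"
    show "\<phi> x = (\<lambda>i p. 0) \<longleftrightarrow> x \<in> U"
    proof
      assume 0: "\<phi> x = (\<lambda>i p. 0)"
      \<comment> \<open>A form vanishing at all \<open>(n, 1)\<close> has zero coefficients, and the
        binomial weights are nonzero, so every functional in the dual family kills
        \<open>W x i\<close>.\<close>
      have "W x i \<in> U" if i: "i \<le> k" for i
      proof (rule sep[OF _ ballI])
        show "W x i \<in> hvec k U" using coordinates_hvec[OF RW[OF x] i] .
        fix b assume b: "b \<in> B"
        have "(\<Sum>i\<le>k. (of_nat (k choose i) * lam b (W x i)) * of_nat n ^ i) = 0" for n :: nat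
        proof -
          have "P (W x) b (of_nat n, 1) = 0" using fun_cong[OF 0, of b] b by (simp add: \<phi>_def)
          then show ?thesis by (simp add: P_def)
        qed
        from poly_nat_zero[OF this i] show "lam b (W x i) = 0" using i by simp
      qed
      then show "x \<in> U" by (rule coordinates_all_mem[OF U RW[OF x]])
    next
      assume "x \<in> U"
      then have "\<phi> x b = (\<lambda>p. 0)" for b
        using \<phi>_eq[OF x coordinates_zero[OF U], of b] P_zero[of b] \<phi>_out[of b] by (cases "b \<in> B") simp_all
      then show "\<phi> x = (\<lambda>i p. 0)" by blast
    qed
  qed
qed

subsection \<open>Vectors fixed by the upper unipotent\<close>

abbreviation up :: "int^2^2" where "up \<equiv> mat2 1 1 0 1"
abbreviation weyl :: "int^2^2" where "weyl \<equiv> mat2 0 (- 1) 1 0"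
abbreviation neg :: "int^2^2" where "neg \<equiv> mat2 (- 1) 0 0 (- 1)"

text \<open>The second condition says that the central element -1 acts on \<open>v\<close> by the
  scalar \<open>e\<close> modulo \<open>U\<close>; it becomes the sign rule for functions on
  primitive vectors.\<close>

definition fixvec :: "rat \<Rightarrow> 'v set \<Rightarrow> 'v \<Rightarrow> bool" where
  "fixvec e U v \<longleftrightarrow> act up v - v \<in> U \<and> act neg v - smul e v \<in> U"

lemma fixvec_mono: "U \<subseteq> U' \<Longrightarrow> fixvec e U v \<Longrightarrow> fixvec e U' v"
  by (auto simp: fixvec_def)

lemma fixvec_cong:
  assumes U: "submod U" and d: "x - y \<in> U" and y: "fixvec e U y"
  shows "fixvec e U x"
proof -
  note sU = submod_subspace[OF U]
  have "act up (x - y) - (x - y) \<in> U"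
    by (rule V.subspace_diff[OF sU submod_act[OF U _ d] d]) simp
  moreover have "act neg (x - y) - smul e (x - y) \<in> U"
    by (rule V.subspace_diff[OF sU submod_act[OF U _ d] V.subspace_scale[OF sU d]]) simp
  ultimately have "act up (x - y) - (x - y) + (act up y - y) \<in> U"
    "act neg (x - y) - smul e (x - y) + (act neg y - smul e y) \<in> U"
    using y V.subspace_add[OF sU] unfolding fixvec_def by blast+
  then show ?thesis by (simp add: fixvec_def act_diff V.scale_right_diff_distrib)
qed

lemma annihilator_fixvec:
  assumes U: "submod U" and v: "fixvec e U v" and f: "f \<in> annihilator U" and g: "g \<in> SL2Z"
  shows "f (act g (act (mat2 1 n 0 1) v)) = f (act g v)"
proof -
  let ?s = "\<lambda>n. f (act g (act (mat2 1 n 0 1) v))"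
  have "fdiff ?s n = 0" for n
  proof -
    have "mat2 1 (n + 1) 0 1 = mat2 1 n 0 1 ** up" by (simp add: add.commute)
    then have "act (mat2 1 (n + 1) 0 1) v = act (mat2 1 n 0 1) (act up v)" by (simp only: act_act mat2_SL2Z)
    moreover have "f (act g (act (mat2 1 n 0 1) (act up v - v))) = 0"
      using v by (intro annihilatorD(7)[OF f] submod_act[OF U] g) (auto simp: fixvec_def)
    ultimately show ?thesis by (simp add: fdiff_def act_diff g annihilatorD[OF f])
  qed
  then have "?s n = ?s 0" by (rule fdiff_zero_const)
  then show ?thesis by (simp add: act_one)
qed

text \<open>The choice of \<open>g\<close> is immaterial when \<open>v\<close> is fixed modulo
  \<open>U\<close> and \<open>f\<close> vanishes on \<open>U\<close>. The value 0 at non-primitive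
  vectors makes the sign rule hold everywhere.\<close>

definition cusp_eval :: "('v \<Rightarrow> rat) \<Rightarrow> 'v \<Rightarrow> int \<Rightarrow> int \<Rightarrow> rat" where
  "cusp_eval f v x y =
    (if coprime x y then f (act (SOME g. g \<in> SL2Z \<and> g$1$1 = x \<and> g$2$1 = y) v) else 0)"

lemma cusp_eval_eq:
  assumes U: "submod U" and v: "fixvec e U v" and f: "f \<in> annihilator U" and det: "a * d - b * c = 1"
  shows "cusp_eval f v a c = f (act (mat2 a b c d) v)"
proof -
  have cop: "coprime a c" using det by (rule SL2Z_column_coprime)
  define g where "g = (SOME g. g \<in> SL2Z \<and> g$1$1 = a \<and> g$2$1 = c)"
  have "\<exists>g. g \<in> SL2Z \<and> g$1$1 = a \<and> g$2$1 = c"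
    using det by (intro exI[of _ "mat2 a b c d"]) simp
  then have "g \<in> SL2Z \<and> g$1$1 = a \<and> g$2$1 = c" unfolding g_def by (rule someI_ex)
  then obtain b' d' where g: "g = mat2 a b' c d'" and det': "a * d' - b' * c = 1"
    by (metis mat2_eta mat2_SL2Z)
  \<comment> \<open>Two matrices of determinant one with the same first column differ by an upper
    unipotent on the right; this is its exponent.\<close>
  define n where "n = d * b' - b * d'"
  have "a * n + b = b'" "c * n + d = d'" using det det' unfolding n_def by algebra+
  then have "g = mat2 a b c d ** mat2 1 n 0 1" by (simp add: g)
  then have "act g v = act (mat2 a b c d) (act (mat2 1 n 0 1) v)" using det by (simp only: act_act mat2_SL2Z)
  then show ?thesis
    using annihilator_fixvec[OF U v f, of "mat2 a b c d" n] det cop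
    by (simp add: cusp_eval_def g_def[symmetric])
qed

section \<open>The leading coefficient operator\<close>

definition top_op :: "nat \<Rightarrow> 'v \<Rightarrow> 'v" where
  "top_op k v = smul (1 / fact k) ((dlt up ^^ k) (act weyl v))"

lemma fact_top_op: "(dlt up ^^ k) (act weyl v) = smul (fact k) (top_op k v)"
  by (simp add: top_op_def)

lemma top_op_mem: "submod U \<Longrightarrow> v \<in> U \<Longrightarrow> top_op k v \<in> U"
  by (simp add: top_op_def V.subspace_scale submod_subspace dlt_pow_mem submod_act)

lemma top_op_add: "top_op k (x + y) = top_op k x + top_op k y"
  by (simp add: top_op_def act_simps dlt_pow_linear V.scale_right_distrib)

lemma top_op_scale: "top_op k (smul r x) = smul r (top_op k x)"
  by (simp add: top_op_def act_simps dlt_pow_linear mult.commute)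

lemma top_op_diff: "top_op k (x - y) = top_op k x - top_op k y"
  using top_op_add[of k "x - y" y] by simp

lemma act_neg_comm: "g \<in> SL2Z \<Longrightarrow> act neg (act g x) = act g (act neg x)"
  by (erule SL2Z_cases) (simp add: act_act)

lemma act_neg_dlt: "g \<in> SL2Z \<Longrightarrow> act neg ((dlt g ^^ k) x) = (dlt g ^^ k) (act neg x)"
  by (induction k) (simp_all add: dlt_def act_simps act_neg_comm)

lemma act_neg_top_op: "act neg (top_op k v) = top_op k (act neg v)"
  by (simp add: top_op_def act_simps act_neg_dlt act_neg_comm)

text \<open>Up to \<open>1 / k!\<close>, applying \<open>u - 1\<close> to \<open>top_op k v\<close>
  gives the next power of \<open>u - 1\<close> on the Weyl image of \<open>v\<close>; the sign
  persists because -1 is central.\<close>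

lemma fixvec_top_op:
  assumes U: "submod U" and v: "fixvec e U v" and deg: "(dlt up ^^ Suc k) (act weyl v) \<in> U"
  shows "fixvec e U (top_op k v)"
proof -
  have "act up (top_op k v) - top_op k v = smul (1 / fact k) ((dlt up ^^ Suc k) (act weyl v))"
    by (simp add: top_op_def act_simps V.scale_right_diff_distrib dlt_def[of up "(dlt up ^^ k) x" for x])
  moreover have "act neg (top_op k v) - smul e (top_op k v) = top_op k (act neg v - smul e v)"
    by (simp add: act_neg_top_op top_op_diff top_op_scale)
  ultimately show ?thesis
    using v deg by (auto simp: fixvec_def intro: V.subspace_scale submod_subspace U top_op_mem)
qed

text \<open>The matrix \<open>mat2 n (- 1) 1 0\<close> is the \<open>n\<close>-th power of
  \<open>up\<close> times \<open>weyl\<close>, and its product with \<open>mat2 a b c d\<close> on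
  the left has first column \<open>(b + n a, d + n c)\<close>. Differences along the line are
  therefore powers of \<open>up - 1\<close>.\<close>

lemma cusp_eval_column:
  assumes U: "submod U" and v: "fixvec e U v" and f: "f \<in> annihilator U" and det: "a * d - b * c = 1"
  shows "(fdiff ^^ k) (\<lambda>n. cusp_eval f v (b + n * a) (d + n * c)) 0
    = f (act (mat2 a b c d) ((dlt up ^^ k) (act weyl v)))"
proof -
  let ?g = "mat2 a b c d"
  let ?s = "\<lambda>n. act (mat2 n (- 1) 1 0) v"
  have g: "?g \<in> SL2Z" using det by simp
  have "cusp_eval f v (b + n * a) (d + n * c) = f (act ?g (?s n))" for n
  proof -
    have "cusp_eval f v (b + n * a) (d + n * c) = f (act (mat2 (b + n * a) (- a) (d + n * c) (- c)) v)"
      by (rule cusp_eval_eq[OF U v f]) (use det in algebra)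
    also have "mat2 (b + n * a) (- a) (d + n * c) (- c) = ?g ** mat2 n (- 1) 1 0"
      by (simp add: algebra_simps)
    also have "act \<dots> v = act ?g (?s n)" by (rule act_act[symmetric]; use det in simp)
    finally show ?thesis .
  qed
  then have "(fdiff ^^ k) (\<lambda>n. cusp_eval f v (b + n * a) (d + n * c)) 0 = (fdiff ^^ k) (\<lambda>n. f (act ?g (?s n))) 0"
    by simp
  also have "\<dots> = f (act ?g ((fdiff ^^ k) ?s 0))"
    by (rule fdiff_pow_additive[symmetric]) (simp add: act_diff det annihilatorD[OF f])
  also have "(fdiff ^^ k) ?s 0 = (dlt up ^^ k) (?s 0)"
    by (rule dlt_pow_fdiff[symmetric]) (simp_all add: act_act)
  finally show ?thesis by simp
qed

lemma deg_less_cusp_eval: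
  assumes "submod U" "fixvec e U v" "f \<in> annihilator U" "(dlt up ^^ D) (act weyl v) \<in> U"
  shows "deg_less D (cusp_eval f v)"
  unfolding deg_less_def
  using cusp_eval_column[OF assms(1-3)] annihilatorD(7)[OF assms(3)] submod_act[OF assms(1) _ assms(4)] by simp

text \<open>Only a congruence between \<open>top_op k v\<close> and \<open>w\<close> is asked for,
  so that the lemma also covers \<open>w = v\<close> for vectors fixed by the operator modulo
  \<open>U\<close>.\<close>

lemma lead_cusp_eval:
  assumes U: "submod U" and v: "fixvec e U v" and f: "f \<in> annihilator U"
    and w: "fixvec e U w" and d: "top_op k v - w \<in> U"
  shows "lead k (cusp_eval f v) (cusp_eval f w)"
  unfolding lead_def
proof (intro allI impI)
  fix a b c d :: int assume det: "a * d - b * c = 1"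
  have "f (act (mat2 a b c d) (top_op k v)) = f (act (mat2 a b c d) w)"
    using annihilator_diff[OF annihilator_comp(1)[OF f U] assms(5), of "mat2 a b c d"] det by simp
  then show "(fdiff ^^ k) (\<lambda>n. cusp_eval f v (b + n * a) (d + n * c)) 0 = fact k * cusp_eval f w a c"
    using det by (simp add: cusp_eval_column[OF U v f] fact_top_op cusp_eval_eq[OF U w f] act_smul annihilatorD[OF f])
qed

end

text \<open>This is the transvection \<open>x \<mapsto> x + det(p, x) p\<close> for
  \<open>p = (a, c)\<close>; its difference from the identity has square zero because
  \<open>det(p, p) = 0\<close>.\<close>

lemma unipotent_transvection: "unipotent (mat2 (1 - a * c) (a * a) (- (c * c)) (1 + a * c))"
proof -
  let ?u = "mat2 (1 - a * c) (a * a) (- (c * c)) (1 + a * c)"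
  let ?N = "mat2 (- (a * c)) (a * a) (- (c * c)) (a * c)"
  have N: "?u - mat 1 = ?N"
    by (simp add: vec_eq_iff forall_2 mat_def)
  have "?N ** (?N ** mat 1) = 0"
    by (simp add: vec_eq_iff forall_2)
  then have "((\<lambda>M. (?u - mat 1) ** M) ^^ 2) (mat 1) = 0"
    unfolding N numeral_2_eq_2 funpow.simps o_apply id_apply .
  moreover have "?u \<in> SL2Z" by (simp add: algebra_simps)
  ultimately show ?thesis unfolding unipotent_def by blast
qed

section \<open>Modules on which every unipotent satisfies \<open>(u - 1)^5 = 0\<close>\<close>

locale short_sl2_module = sl2_module smul act
  for smul :: "rat \<Rightarrow> 'v::ab_group_add \<Rightarrow> 'v" and act :: "int^2^2 \<Rightarrow> 'v \<Rightarrow> 'v" +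
  assumes short: "\<And>u. unipotent u \<Longrightarrow> ((\<lambda>v. act u v - v) ^^ 5) = (\<lambda>v. 0)"
begin

lemma dlt_transvection: "(dlt (mat2 (1 - a * c) (a * a) (- (c * c)) (1 + a * c)) ^^ 5) x = 0"
  using short[OF unipotent_transvection] unfolding dlt_def[abs_def] by metis

lemma dlt_up: "(dlt up ^^ 5) x = 0"
  using dlt_transvection[of 1 0] by simp

text \<open>The sign rule comes from -1. Powers of the transvection along \<open>(a, c)\<close> move
  \<open>(b, d)\<close> through the points of the line in question, so its fifth difference is a
  value of the fifth power of the transvection minus 1.\<close>

lemma cusp_fun_cusp_eval:
  assumes U: "submod U" and v: "fixvec e U v" and f: "f \<in> annihilator U"
  shows "cusp_fun e (cusp_eval f v)"
  unfolding cusp_fun_def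
proof (intro conjI allI impI)
  fix x y :: int
  show "cusp_eval f v (- x) (- y) = e * cusp_eval f v x y"
  proof (cases "coprime x y")
    case True
    then obtain b d where det: "x * d - b * y = 1" by (rule ex_SL2Z_column)
    let ?g = "mat2 x b y d"
    have "cusp_eval f v (- x) (- y) = f (act (mat2 (- x) (- b) (- y) (- d)) v)"
      by (rule cusp_eval_eq[OF U v f]) (use det in simp)
    also have "mat2 (- x) (- b) (- y) (- d) = ?g ** neg" by simp
    also have "act \<dots> v = act ?g (act neg v)" by (rule act_act[symmetric]; use det in simp)
    also have "f (act ?g (act neg v)) = f (act ?g (smul e v))"
      using annihilator_diff[OF annihilator_comp(1)[OF f U], of ?g "act neg v" "smul e v"] det v
      by (simp add: fixvec_def)
    also have "\<dots> = e * f (act ?g v)" using det by (simp add: act_smul annihilatorD[OF f])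
    also have "f (act ?g v) = cusp_eval f v x y"
      by (rule cusp_eval_eq[OF U v f det, symmetric])
    finally show ?thesis .
  next
    case False
    then show ?thesis by (simp add: cusp_eval_def)
  qed
next
  fix a b c d :: int assume "coprime a c" "coprime b d"
  then obtain b' d' where det: "b * d' - b' * d = 1" using ex_SL2Z_column by metis
  let ?g = "mat2 b b' d d'"
  \<comment> \<open>\<open>t n\<close> is the \<open>n\<close>-th power of the transvection
    \<open>t 1\<close>.\<close>
  define t where "t n = mat2 (1 - n * a * c) (n * a * a) (- (n * c * c)) (1 + n * a * c)" for n
  have t: "t n \<in> SL2Z" for n by (simp add: t_def algebra_simps)
  let ?s = "\<lambda>n. act (t n) (act ?g v)"
  have "cusp_eval f v (b + n * (a * d - b * c) * a) (d + n * (a * d - b * c) * c) = f (?s n)" for n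
  proof -
    have "t n ** ?g = mat2 (b + n * (a * d - b * c) * a) ((1 - n * a * c) * b' + n * a * a * d')
       (d + n * (a * d - b * c) * c) (- (n * c * c) * b' + (1 + n * a * c) * d')"
      by (simp add: t_def algebra_simps)
    moreover have "t n ** ?g \<in> SL2Z" using t det by simp
    ultimately show ?thesis
      using cusp_eval_eq[OF U v f] det by (simp add: act_act t)
  qed
  then have "(fdiff ^^ 5) (\<lambda>n. cusp_eval f v (b + n * (a * d - b * c) * a) (d + n * (a * d - b * c) * c)) 0
      = (fdiff ^^ 5) (\<lambda>n. f (?s n)) 0" by simp
  also have "\<dots> = f ((fdiff ^^ 5) ?s 0)"
    by (rule fdiff_pow_additive[symmetric]) (simp add: annihilatorD[OF f])
  also have "(fdiff ^^ 5) ?s 0 = (dlt (t 1) ^^ 5) (?s 0)"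
  proof (rule dlt_pow_fdiff[symmetric, OF t])
    fix n
    have "t 1 ** t n = t (n + 1)" by (simp add: t_def algebra_simps)
    then show "?s (n + 1) = act (t 1) (?s n)" using t det by (simp add: act_act matrix_mul_assoc)
  qed
  also have "\<dots> = 0" using dlt_transvection by (simp add: t_def)
  finally show "(fdiff ^^ 5) (\<lambda>n. cusp_eval f v (b + n * (a * d - b * c) * a) (d + n * (a * d - b * c) * c)) 0 = 0"
    by (simp add: annihilatorD[OF f])
qed

lemma cusp_eval_base:
  assumes "submod U" "fixvec e U v" "f \<in> annihilator U"
  shows "cusp_eval f v 1 0 = f v"
  using cusp_eval_eq[OF assms, of 1 1 0 0] by (simp add: act_one)

text \<open>All claims are congruences modulo \<open>U\<close>, tested by functionals. For each
  functional they reduce to the numerical certificates, whose conclusions at \<open>(1, 0)\<close>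
  give the value on the vector itself.\<close>

lemma top_op_relations:
  assumes U: "submod U" and k: "k \<le> 4" and e: "e = 1 \<or> e = - 1" and v: "fixvec e U v"
    and deg: "(dlt up ^^ Suc k) (act weyl v) \<in> U"
  defines "h \<equiv> top_op k (top_op k v)"
  shows "fixvec e U h \<and> top_op k h - h \<in> U \<and> (e = (- 1) ^ k \<or> h \<in> U)"
proof -
  define v1 where "v1 = top_op k v"
  note sU = submod_subspace[OF U]
  have zU: "0 \<in> U" using V.subspace_0[OF sU] .
  have v1: "fixvec e U v1" unfolding v1_def by (rule fixvec_top_op[OF U v deg])
  have F0: "cusp_fun e (cusp_eval f v)" if "f \<in> annihilator U" for f
    by (rule cusp_fun_cusp_eval[OF U v that])
  have F1: "cusp_fun e (cusp_eval f v1)" if "f \<in> annihilator U" for f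
    by (rule cusp_fun_cusp_eval[OF U v1 that])
  have D: "deg_less (Suc k) (cusp_eval f v)" if "f \<in> annihilator U" for f
    by (rule deg_less_cusp_eval[OF U v that deg])
  have L0: "lead k (cusp_eval f v) (cusp_eval f v1)" if "f \<in> annihilator U" for f
    by (rule lead_cusp_eval[OF U v that v1]) (simp add: v1_def zU)
  note base0 = cusp_eval_base[OF U v] and base1 = cusp_eval_base[OF U v1]
  have trivial: ?thesis if m: "v1 \<in> U"
  proof -
    have h: "h \<in> U" unfolding h_def v1_def[symmetric] by (rule top_op_mem[OF U m])
    have "fixvec e U 0" by (simp add: fixvec_def act_simps zU)
    then have "fixvec e U h" using fixvec_cong[OF U, of h 0] h by simp
    moreover have "top_op k h - h \<in> U" by (intro V.subspace_diff sU top_op_mem U h)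
    ultimately show ?thesis using h by blast
  qed
  have idem: ?thesis if m: "h - v1 \<in> U" and ek: "e = (- 1) ^ k"
  proof -
    have "fixvec e U h" by (rule fixvec_cong[OF U m v1])
    moreover have "top_op k h - h \<in> U"
    proof -
      have "top_op k h - h = top_op k (h - v1)" by (simp add: top_op_diff) (simp add: h_def v1_def)
      then show ?thesis using top_op_mem[OF U m] by simp
    qed
    ultimately show ?thesis using ek by blast
  qed
  \<comment> \<open>For \<open>k < 4\<close> the vector \<open>h\<close> is not yet known to be
    fixed modulo \<open>U\<close>, so it is read off as a difference of the function of
    \<open>v1\<close> rather than through a function of its own.\<close>
  have col: "(fdiff ^^ k) (\<lambda>n. cusp_eval f v1 n 1) 0 = fact k * f h" if "f \<in> annihilator U" for f
    using cusp_eval_column[OF U v1 that, of 1 1 0 0 k]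
    by (simp add: act_one fact_top_op annihilatorD[OF that] h_def v1_def)
  consider "k = 0" | "k = 1" | "k = 2" | "k = 3" | "k = 4" using k by linarith
  then show ?thesis
  proof cases
    case 1
    \<comment> \<open>In degree 0 the function is constant along unimodular lines, and such lines
      join both \<open>(1, 0)\<close> and \<open>(-1, 0)\<close> to \<open>(0, 1)\<close>.\<close>
    have F10: "cusp_eval f v 1 0 = cusp_eval f v 0 1" "e * cusp_eval f v 1 0 = cusp_eval f v 0 1"
      if f: "f \<in> annihilator U" for f
    proof -
      have L: "cusp_eval f v (b + a) (d + c) = cusp_eval f v b d" if "a * d - b * c = 1" for a b c d
        using line[OF D[OF f, unfolded 1], of a d b c] that by (simp add: fdiff_def)
      show "cusp_eval f v 1 0 = cusp_eval f v 0 1"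
        using L[where a = 0 and b = 1 and c = "- 1" and d = 1] L[where a = 1 and b = 0 and c = 0 and d = 1] by simp
      show "e * cusp_eval f v 1 0 = cusp_eval f v 0 1"
        using L[where a = 0 and b = "- 1" and c = 1 and d = 0] L[where a = 1 and b = "- 1" and c = 0 and d = 1]
          cusp_fun_sign[OF F0[OF f], of 1 0] by simp
    qed
    have v1w: "f v1 = cusp_eval f v 0 1" if f: "f \<in> annihilator U" for f
      using cusp_eval_eq[OF U v f, of 0 0 "- 1" 1] by (simp add: v1_def top_op_def 1)
    from e show ?thesis
    proof
      assume e1: "e = 1"
      have m: "v1 - v \<in> U"
        by (rule subspace_separation[OF sU]) (simp add: annihilatorD v1w F10 base0[symmetric])
      show ?thesis
        by (rule idem) (use top_op_mem[OF U m, of k] in \<open>simp_all add: top_op_diff h_def v1_def 1 e1\<close>)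
    next
      assume e1: "e = - 1"
      show ?thesis
      proof (rule trivial, rule subspace_separation[OF sU])
        fix f assume f: "f \<in> annihilator U"
        show "f v1 = 0" using F10[OF f] v1w[OF f] e1 by simp
      qed
    qed
  next
    case 2
    from e show ?thesis
    proof
      assume e1: "e = 1"
      show ?thesis
      proof (rule trivial, rule subspace_separation[OF sU])
        fix f assume f: "f \<in> annihilator U"
        show "f v1 = 0"
          using lead_even_1[OF F0[OF f, unfolded e1] F1[OF f, unfolded e1] _ L0[OF f, unfolded 2]] D[OF f] base1[OF f]
          by (simp add: 2 numeral_2_eq_2)
      qed
    next
      assume e1: "e = - 1"
      have m: "v1 - v \<in> U"
      proof (rule subspace_separation[OF sU])
        fix f assume f: "f \<in> annihilator U"
        show "f (v1 - v) = 0"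
          using lead_odd_1[OF F0[OF f, unfolded e1] F1[OF f, unfolded e1] _ L0[OF f, unfolded 2]] D[OF f] base1[OF f] base0[OF f]
          by (simp add: 2 numeral_2_eq_2 annihilatorD[OF f])
      qed
      show ?thesis
        by (rule idem) (use top_op_mem[OF U m, of k] in \<open>simp_all add: top_op_diff h_def v1_def 2 e1\<close>)
    qed
  next
    case 3
    from e show ?thesis
    proof
      assume e1: "e = 1"
      show ?thesis
      proof (rule idem[OF subspace_separation[OF sU]])
        fix f assume f: "f \<in> annihilator U"
        show "f (h - v1) = 0"
          using lead_sq_even_2[OF F0[OF f, unfolded e1] F1[OF f, unfolded e1] _ L0[OF f, unfolded 3]] D[OF f] base1[OF f] col[OF f]
          by (simp add: 3 annihilatorD[OF f])
      qed (simp add: 3 e1)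
    next
      assume e1: "e = - 1"
      show ?thesis
      proof (rule trivial, rule subspace_separation[OF sU])
        fix f assume f: "f \<in> annihilator U"
        show "f v1 = 0"
          using lead_odd_2[OF F0[OF f, unfolded e1] F1[OF f, unfolded e1] _ L0[OF f, unfolded 3]] D[OF f] base1[OF f]
          by (simp add: 3)
      qed
    qed
  next
    case 4
    from e show ?thesis
    proof
      assume e1: "e = 1"
      show ?thesis
      proof (rule trivial, rule subspace_separation[OF sU])
        fix f assume f: "f \<in> annihilator U"
        show "f v1 = 0"
          using lead_even_3[OF F0[OF f, unfolded e1] F1[OF f, unfolded e1] _ L0[OF f, unfolded 4]] D[OF f] base1[OF f]
          by (simp add: 4)
      qed
    next
      assume e1: "e = - 1"
      show ?thesis
      proof (rule idem[OF subspace_separation[OF sU]])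
        fix f assume f: "f \<in> annihilator U"
        show "f (h - v1) = 0"
          using lead_sq_odd_3[OF F0[OF f, unfolded e1] F1[OF f, unfolded e1] _ L0[OF f, unfolded 4]] D[OF f] base1[OF f] col[OF f]
          by (simp add: 4 annihilatorD[OF f] fact_values)
      qed (simp add: 4 e1)
    qed
  next
    case 5
    \<comment> \<open>For \<open>k = 4\<close> the degree condition holds for every vector since
      \<open>(u - 1)^5 = 0\<close>, so the operator can be iterated on fixed vectors.\<close>
    have fixed: "fixvec e U (top_op k x)" if "fixvec e U x" for x
      by (rule fixvec_top_op[OF U that]) (simp only: 5 eval_nat_numeral[symmetric] dlt_up zU)
    have h: "fixvec e U h" unfolding h_def using fixed v by blast
    have F2: "cusp_fun e (cusp_eval f h)" if "f \<in> annihilator U" for f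
      by (rule cusp_fun_cusp_eval[OF U h that])
    have L1: "lead k (cusp_eval f v1) (cusp_eval f h)" if "f \<in> annihilator U" for f
      by (rule lead_cusp_eval[OF U v1 that h]) (simp add: h_def v1_def zU)
    from e show ?thesis
    proof
      assume e1: "e = 1"
      have h': "fixvec e U (top_op k h)" using fixed h by blast
      have "top_op k h - h \<in> U"
      proof (rule subspace_separation[OF sU])
        fix f assume f: "f \<in> annihilator U"
        have F3: "cusp_fun e (cusp_eval f (top_op k h))"
          by (rule cusp_fun_cusp_eval[OF U h' f])
        have L2: "lead k (cusp_eval f h) (cusp_eval f (top_op k h))"
          by (rule lead_cusp_eval[OF U h f h']) (simp add: zU)
        have "cusp_eval f (top_op k h) 1 0 = cusp_eval f h 1 0"
          using lead_cube_even_4[of "cusp_eval f v" "cusp_eval f v1" "cusp_eval f h" "cusp_eval f (top_op k h)"]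
            F0[OF f] F1[OF f] F2[OF f] F3 L0[OF f] L1[OF f] L2 by (simp add: e1 5)
        then show "f (top_op k h - h) = 0"
          using cusp_eval_base[OF U h f] cusp_eval_base[OF U h' f] by (simp add: annihilatorD[OF f])
      qed
      with h show ?thesis by (simp add: e1 5)
    next
      assume e1: "e = - 1"
      have hU: "h \<in> U"
      proof (rule subspace_separation[OF sU])
        fix f assume f: "f \<in> annihilator U"
        show "f h = 0"
          using lead_sq_odd_4[of "cusp_eval f v" "cusp_eval f v1" "cusp_eval f h"]
            F0[OF f] F1[OF f] F2[OF f] L0[OF f] L1[OF f] cusp_eval_base[OF U h f] by (simp add: e1 5)
      qed
      then have "top_op k h - h \<in> U" by (intro V.subspace_diff sU top_op_mem U)
      with h hU show ?thesis by blast
    qed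
  qed
qed

subsection \<open>Descent on the degree\<close>

text \<open>Every functional turns the orbit of \<open>h\<close> into a function equal to its own
  leading coefficient, hence into a form. The interpolation matrix assembles these forms into one
  with coefficients in the module.\<close>

lemma homogeneous_in_hvec:
  assumes U: "submod U" and k: "k \<le> 4" and h: "fixvec ((- 1) ^ k) U h" and T: "top_op k h - h \<in> U"
  shows "h \<in> hvec k U"
proof -
  obtain A :: "nat \<Rightarrow> nat \<Rightarrow> rat" where A: "\<And>F x y. hom_fun k F \<Longrightarrow> coprime x y \<Longrightarrow>
      F x y = form k (\<lambda>i. \<Sum>l\<le>k. A i l * F (fst (node k l)) (snd (node k l))) (of_int x) (of_int y)"
    using hom_fun_eq_form[OF k] by blast
  \<comment> \<open>\<open>M l\<close> is a matrix whose first column is the interpolation node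
    \<open>node k l\<close>.\<close>
  define M where "M l = (if l = k then mat2 1 0 0 1 else mat2 (int l - 1) (- 1) 1 0)" for l
  define c where "c i = (\<Sum>l\<le>k. smul (A i l) (act (M l) h))" for i
  have "coeffs k U h c"
    unfolding coeffs_def
  proof
    fix g assume "g \<in> SL2Z"
    then obtain a b e d where g: "g = mat2 a b e d" and det: "a * d - b * e = 1" by (rule SL2Z_cases)
    show "act g h - vform k c (of_int (g$1$1)) (of_int (g$2$1)) \<in> U"
    proof (rule subspace_separation[OF submod_subspace[OF U]])
      fix f assume f: "f \<in> annihilator U"
      let ?F = "cusp_eval f h"
      have hom: "hom_fun k ?F"
        unfolding hom_fun_def using cusp_fun_cusp_eval[OF U h f] lead_cusp_eval[OF U h f h T] by blast
      have node: "?F (fst (node k l)) (snd (node k l)) = f (act (M l) h)" for l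
        using cusp_eval_eq[OF U h f, of 1 1 0 0] cusp_eval_eq[OF U h f, of "int l - 1" 0 "- 1" 1]
        by (simp add: node_def M_def)
      have "f (act g h) = ?F a e" using cusp_eval_eq[OF U h f det] by (simp add: g)
      also have "\<dots> = form k (\<lambda>i. \<Sum>l\<le>k. A i l * f (act (M l) h)) (of_int a) (of_int e)"
        using A[OF hom SL2Z_column_coprime[OF det]] by (simp only: node)
      also have "\<dots> = f (vform k c (of_int a) (of_int e))"
        by (simp add: annihilator_vform[OF f] c_def annihilatorD[OF f])
      finally show "f (act g h - vform k c (of_int (g$1$1)) (of_int (g$2$1))) = 0"
        by (simp add: g annihilatorD[OF f])
    qed
  qed
  then show ?thesis by (auto simp: hvec_def)
qed

section \<open>Bounded iteration of the extensions\<close>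

definition sweep :: "'v set \<Rightarrow> 'v set" where
  "sweep U = next_sub 4 (next_sub 3 (next_sub 2 (next_sub 1 (next_sub 0 U))))"

lemma submod_sweep: "submod U \<Longrightarrow> submod (sweep U)"
  by (simp add: sweep_def submod_next_sub)

lemma submod_sweeps: "submod U \<Longrightarrow> submod ((sweep ^^ n) U)"
  by (induction n) (simp_all add: submod_sweep)

text \<open>By monotonicity it does no harm that the extensions of the other degrees are also
  performed; a sweep can thus absorb homogeneous vectors of any degree up to 4.\<close>

lemma next_sub_subset_sweep:
  assumes "k \<le> 4"
  shows "next_sub k U \<subseteq> sweep U"
proof -
  have "k = 0 \<or> k = 1 \<or> k = 2 \<or> k = 3 \<or> k = 4" using assms by linarith
  then show ?thesis
    unfolding sweep_def
    by (elim disjE; hypsubst; meson next_sub_mono subset_next_sub subset_trans)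
qed

lemma subset_sweep: "U \<subseteq> sweep U"
  using next_sub_subset_sweep[of 0 U] subset_next_sub by blast

lemma subset_sweeps: "U \<subseteq> (sweep ^^ n) U"
  by (induction n) (use subset_sweep in auto)

text \<open>The number of sweeps must not depend on \<open>U\<close>, since the induction hypothesis
  is used over two larger submodules: first to absorb \<open>T v\<close>, then to absorb
  \<open>v\<close>. The bound goes from \<open>m\<close> to \<open>2 m + 1\<close>.\<close>

lemma descent:
  assumes "k \<le> 5"
  shows "\<exists>m. \<forall>U v e. submod U \<longrightarrow> e = 1 \<or> e = - 1 \<longrightarrow> fixvec e U v \<longrightarrow>
    (dlt up ^^ k) (act weyl v) \<in> U \<longrightarrow> v \<in> (sweep ^^ m) U"
  using assms
proof (induction k)
  case 0
  have "v \<in> U" if "submod U" "act weyl v \<in> U" for U v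
    using submod_act[OF that(1) _ that(2), of "mat2 0 1 (- 1) 0"] by (simp add: act_act act_one)
  then show ?case by (intro exI[of _ 0]) simp
next
  case (Suc k)
  then obtain m where m: "\<And>U v e. submod U \<Longrightarrow> e = 1 \<or> e = - 1 \<Longrightarrow> fixvec e U v \<Longrightarrow>
    (dlt up ^^ k) (act weyl v) \<in> U \<Longrightarrow> v \<in> (sweep ^^ m) U" by auto
  have "v \<in> (sweep ^^ (m + (m + 1))) U"
    if U: "submod U" and e: "e = 1 \<or> e = - 1" and v: "fixvec e U v"
      and deg: "(dlt up ^^ Suc k) (act weyl v) \<in> U" for U v e
  proof -
    have k: "k \<le> 4" using Suc.prems by simp
    define v1 where "v1 = top_op k v"
    define h where "h = top_op k v1"
    have rel: "fixvec e U h" "top_op k h - h \<in> U" "e = (- 1) ^ k \<or> h \<in> U"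
      using top_op_relations[OF U k e v deg] by (simp_all add: h_def v1_def)
    have "h \<in> hvec k U"
      using rel homogeneous_in_hvec[OF U k] subset_hvec[OF U] by blast
    then have h: "h \<in> sweep U"
      using hvec_subset_next_sub next_sub_subset_sweep[OF k] by blast
    let ?U1 = "sweep U" and ?U2 = "(sweep ^^ m) (sweep U)"
    note U1 = submod_sweep[OF U]
    note U2 = submod_sweeps[OF U1, of m]
    have "fixvec e U v1" unfolding v1_def by (rule fixvec_top_op[OF U v deg])
    then have "fixvec e ?U1 v1" using fixvec_mono[OF subset_sweep] by blast
    \<comment> \<open>The leading coefficient of \<open>v1\<close> is \<open>h\<close>, which one
      sweep has absorbed, so modulo \<open>?U1\<close> the degree of \<open>v1\<close> is below
      \<open>k\<close>.\<close>
    moreover have "(dlt up ^^ k) (act weyl v1) \<in> ?U1"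
      using V.subspace_scale[OF submod_subspace[OF U1] h] by (simp add: fact_top_op h_def)
    ultimately have v1: "v1 \<in> ?U2" using m[OF U1 e] by blast
    have "U \<subseteq> ?U2" using subset_sweep subset_sweeps by blast
    then have "fixvec e ?U2 v" using fixvec_mono v by blast
    moreover have "(dlt up ^^ k) (act weyl v) \<in> ?U2"
      using V.subspace_scale[OF submod_subspace[OF U2] v1] by (simp add: fact_top_op v1_def)
    ultimately have "v \<in> (sweep ^^ m) ?U2" using m[OF U2 e] by blast
    then show ?thesis by (simp only: funpow_add o_apply One_nat_def funpow.simps id_apply)
  qed
  then show ?case by blast
qed

text \<open>The vector is half the sum of its even and odd parts under -1. Both are fixed modulo
  \<open>U\<close>, and their degree is below 5 by the assumption on unipotents.\<close>

lemma fixed_in_sweeps: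
  "\<exists>m. \<forall>U v. submod U \<longrightarrow> act up v - v \<in> U \<longrightarrow> v \<in> (sweep ^^ m) U"
proof -
  obtain m where m: "\<And>U v e. submod U \<Longrightarrow> e = 1 \<or> e = - 1 \<Longrightarrow> fixvec e U v \<Longrightarrow>
    (dlt up ^^ 5) (act weyl v) \<in> U \<Longrightarrow> v \<in> (sweep ^^ m) U"
    using descent[of 5] by auto
  have "v \<in> (sweep ^^ m) U" if U: "submod U" and v: "act up v - v \<in> U" for U v
  proof -
    note sU = submod_subspace[OF U]
    have 0: "0 \<in> U" using V.subspace_0[OF sU] .
    have nn: "act neg (act neg v) = v" by (simp add: act_act act_one)
    have nu: "act up (act neg v) - act neg v = act neg (act up v - v)"
      by (simp add: act_diff act_neg_comm)
    have nv: "act neg (act up v - v) \<in> U" using submod_act[OF U _ v] by simp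
    have "fixvec 1 U (v + act neg v)"
      using V.subspace_add[OF sU v nv] by (simp add: fixvec_def act_simps nn 0 nu[symmetric] algebra_simps)
    moreover have "fixvec (- 1) U (v - act neg v)"
      using V.subspace_diff[OF sU v nv] by (simp add: fixvec_def act_simps nn 0 nu[symmetric] algebra_simps)
    moreover have "(dlt up ^^ 5) (act weyl x) \<in> U" for x by (simp add: dlt_up 0)
    ultimately have pm: "v + act neg v \<in> (sweep ^^ m) U" "v - act neg v \<in> (sweep ^^ m) U"
      using m[OF U] by blast+
    note sM = submod_subspace[OF submod_sweeps[OF U, of m]]
    have "smul (1 / 2) ((v + act neg v) + (v - act neg v)) \<in> (sweep ^^ m) U"
      by (rule V.subspace_scale[OF sM V.subspace_add[OF sM pm]])
    moreover have "(v + act neg v) + (v - act neg v) = smul 2 v"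
      using V.scale_left_distrib[of 1 1 v] by simp
    ultimately show ?thesis by simp
  qed
  then show ?thesis by blast
qed

text \<open>Starting from \<open>(u - 1)^5 x = 0\<close>, each lower power of \<open>u - 1\<close>
  applied to \<open>x\<close> is fixed modulo the submodule that contains the preceding one. Five
  rounds reach \<open>x\<close>, with a number of sweeps independent of \<open>x\<close>.\<close>

lemma sweeps_exhaust: "\<exists>m. (sweep ^^ m) {0} = UNIV"
proof -
  obtain m where m: "\<And>U v. submod U \<Longrightarrow> act up v - v \<in> U \<Longrightarrow> v \<in> (sweep ^^ m) U"
    using fixed_in_sweeps by blast
  have z: "submod {0}" by (simp add: submodule_def V.subspace_single_0 act_zero)
  have "(dlt up ^^ (5 - j)) x \<in> (sweep ^^ (j * m)) {0}" if "j \<le> 5" for j x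
    using that
  proof (induction j)
    case 0
    then show ?case using dlt_up by simp
  next
    case (Suc j)
    let ?y = "(dlt up ^^ (5 - Suc j)) x"
    have "5 - j = Suc (5 - Suc j)" using Suc.prems by simp
    then have "act up ?y - ?y \<in> (sweep ^^ (j * m)) {0}"
      using Suc by (simp add: dlt_def[of up "(dlt up ^^ i) x" for i])
    then have "?y \<in> (sweep ^^ m) ((sweep ^^ (j * m)) {0})"
      by (rule m[OF submod_sweeps[OF z]])
    then show ?case by (simp add: funpow_add)
  qed
  from this[of 5] have "(sweep ^^ (5 * m)) {0} = UNIV" by auto
  then show ?thesis by blast
qed

section \<open>The filtration\<close>

primrec series :: "nat \<Rightarrow> 'v set" where
  "series 0 = {0}"
| "series (Suc j) = next_sub (j mod 5) (series j)"

text \<open>The degrees recur with period 5 in the order used inside a sweep, which refines the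
  sweeps to steps of a single degree.\<close>

lemma series_sweep: "series (5 * n) = (sweep ^^ n) {0}"
proof (induction n)
  case (Suc n)
  have "5 * Suc n = Suc (Suc (Suc (Suc (Suc (5 * n)))))" by simp
  moreover have "(5 * n) mod 5 = 0" "Suc (5 * n) mod 5 = 1" "Suc (Suc (5 * n)) mod 5 = 2"
    "Suc (Suc (Suc (5 * n))) mod 5 = 3" "Suc (Suc (Suc (Suc (5 * n)))) mod 5 = 4" by presburger+
  ultimately have "series (5 * Suc n) = sweep (series (5 * n))"
    by (simp only: series.simps sweep_def)
  then show ?case by (simp only: Suc.IH funpow.simps o_apply)
qed simp

lemma submod_series: "submod (series j)"
  by (induction j) (simp_all add: submod_next_sub submodule_def[of _ _ "{0}"] V.subspace_single_0 act_zero)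

end

theorem theorem1:
  fixes smul :: "rat \<Rightarrow> 'v::ab_group_add \<Rightarrow> 'v"
    and act :: "int^2^2 \<Rightarrow> 'v \<Rightarrow> 'v"
  assumes "QSL2_module smul act"
    and "\<forall>u. unipotent u \<longrightarrow> ((\<lambda>v. act u v - v) ^^ 5) = (\<lambda>v. 0)"
  shows "\<exists>(m::nat) (V :: nat \<Rightarrow> 'v set).
           V 0 = {0} \<and> V m = UNIV \<and>
           (\<forall>j\<le>m. submodule smul act (V j)) \<and>
           (\<forall>j\<in>{1..m}. V (j - 1) \<subseteq> V j \<and>
              (\<exists>k\<le>4. factor_is_sum_Sym smul act k (V (j - 1)) (V j)))"
proof -
  interpret short_sl2_module smul act
    using assms by unfold_locales auto
  obtain m where m: "(sweep ^^ m) {0} = UNIV" using sweeps_exhaust by blast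
  show ?thesis
  proof (rule exI[of _ "5 * m"], rule exI[of _ series], intro conjI ballI allI impI)
    show "series (5 * m) = UNIV" using m by (simp add: series_sweep)
  next
    fix j assume "j \<in> {1..5 * m}"
    then obtain i where j: "j = Suc i" by (cases j) auto
    show "series (j - 1) \<subseteq> series j" by (simp add: j subset_next_sub)
    show "\<exists>k\<le>4. factor_is_sum_Sym smul act k (series (j - 1)) (series j)"
      by (intro exI[of _ "i mod 5"]) (simp add: j factor_next_sub submod_series less_Suc_eq_le[symmetric])
  qed (simp_all add: submod_series)
qed

end
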